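(* There is no Cameron–Liebler line class in $PG(3,4)$ with parameter $x\in\{4,5,6,8\}$.
   Context: Let $q$ be a prime power. A set $\mathcal L$ of lines of the projective space $PG(3,q)$ is a Cameron–Liebler line class with parameter $x$ (an integer) if for every line $l$ of $PG(3,q)$, $$|\{m\in\mathcal L\setminus\{l\}: m \text{ meets } l\}| = (q+1)x+(q^2-1)\chi_{\mathcal L}(l),$$ where $\chi_{\mathcal L}$ is the characteristic function of $\mathcal L$ on the set of lines. *)

theory Defs
  imports "HOL-Analysis.Cartesian_Space" "HOL-Library.Numeral_Type"
begin

text \<open>
  \<open>PG(3,q)\<close> is the lattice of subspaces of \<open>F^4\<close> for a finite field \<open>F\<close>, given as a type
  \<open>'a\<close> with \<open>q = CARD('a)\<close>; points and lines have vector space dimension 1 and 2.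
\<close>

definition pg_points :: "('a::{field,finite} ^ 4) set set" where
  "pg_points = {P. vec.subspace P \<and> vec.dim P = 1}"

definition pg_lines :: "('a::{field,finite} ^ 4) set set" where
  "pg_lines = {l. vec.subspace l \<and> vec.dim l = 2}"

definition pg_meets :: "('a::{field,finite} ^ 4) set \<Rightarrow> ('a ^ 4) set \<Rightarrow> bool" where
  "pg_meets l m \<longleftrightarrow> (\<exists>P\<in>pg_points. P \<subseteq> l \<and> P \<subseteq> m)"

definition cameron_liebler :: "('a::{field,finite} ^ 4) set set \<Rightarrow> int \<Rightarrow> bool" where
  "cameron_liebler \<L> x \<longleftrightarrow>
     \<L> \<subseteq> pg_lines \<and>
     (\<forall>l\<in>pg_lines.
        int (card {m \<in> \<L> - {l}. pg_meets m l}) =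
          (int CARD('a) + 1) * x + ((int CARD('a))\<^sup>2 - 1) * of_bool (l \<in> \<L>))"

end

theory Submission imports Defs begin

text \<open>
  Let \<open>s P\<close>, \<open>p h\<close> and \<open>c P h\<close> be the numbers of lines of the class through a point \<open>P\<close>, in a plane
  \<open>h\<close>, and in the pencil of an incident pair. Double counting gives
  \<open>s P + p h = x + (q + 1) * c P h\<close>, so all points on a line have the same \<open>s\<close> modulo \<open>q + 1\<close>, and
  likewise all planes through it. It also gives the number of lines of the class that meet two
  given skew lines, and from this the sum of all \<open>(s P)\<^sup>2\<close> and \<open>(p h)\<^sup>2\<close> over the points and planes
  incident with a fixed line. For \<open>q = 4\<close> these moments leave very few possible values on a line:
  none on a line outside the class if \<open>x \<in> {4, 8}\<close>. If \<open>x = 5\<close>, a line outside the class has a point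
  or plane of value 10, and a line of the class has none. If \<open>x = 6\<close>, up to duality all
  \<open>s P\<close> are divisible by 5 along lines that are linked by intersections; values 20 of points and 16 of
  planes occur only on lines of the class, hence not at all, and a plane of value 11 on a line of the
  class leads through a line outside it to a point of value 5, which lies on no line of the class.
\<close>

section \<open>Cameron-Liebler line classes in an abstract projective 3-space\<close>

lemma int_card_filter_eq_sum:
  "finite A \<Longrightarrow> int (card {a \<in> A. Q a}) = (\<Sum>a\<in>A. of_bool (Q a))"
  by (simp add: sum_of_bool_eq Int_def)

lemma sum_card_filter_swap:
  assumes "finite A" "finite B"
  shows "(\<Sum>a\<in>A. int (card {b \<in> B. R a b})) = (\<Sum>b\<in>B. int (card {a \<in> A. R a b}))"
  by (simp only: int_card_filter_eq_sum[OF assms(1)] int_card_filter_eq_sum[OF assms(2)])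
    (rule sum.swap)

lemma int_card_remove:
  assumes "finite A"
  shows "int (card (A - {a})) = int (card A) - of_bool (a \<in> A)"
proof (cases "a \<in> A")
  case True
  then have "card A = Suc (card (A - {a}))" using assms by (rule card.remove[rotated])
  then show ?thesis using True by simp
qed simp

lemma card_eq_1_iff_Ex1: "card {a \<in> A. Q a} = 1 \<longleftrightarrow> (\<exists>!a. a \<in> A \<and> Q a)"
proof -
  have "card {a \<in> A. Q a} = 1 \<longleftrightarrow> (\<exists>z. {a \<in> A. Q a} = {z})"
    by (rule card_1_singleton_iff[unfolded One_nat_def[symmetric]])
  also have "\<dots> \<longleftrightarrow> (\<exists>!a. a \<in> A \<and> Q a)"
    by (auto simp: set_eq_iff Ex1_def)
  finally show ?thesis .
qed

text \<open>The axioms are closed under exchanging points and planes. Incidence of a point and a plane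
  is expressed by a line between them.\<close>

locale projective_3space =
  fixes Pt :: "'p set" and Ln :: "'l set" and Pl :: "'h set"
    and on :: "'p \<Rightarrow> 'l \<Rightarrow> bool" and lies :: "'l \<Rightarrow> 'h \<Rightarrow> bool"
    and q :: nat
  assumes finite_Pt: "finite Pt" and finite_Ln: "finite Ln" and finite_Pl: "finite Pl"
    and card_points_on: "l \<in> Ln \<Longrightarrow> card {P \<in> Pt. on P l} = q + 1"
    and card_planes_through: "l \<in> Ln \<Longrightarrow> card {h \<in> Pl. lies l h} = q + 1"
    and card_star: "P \<in> Pt \<Longrightarrow> card {l \<in> Ln. on P l} = q\<^sup>2 + q + 1"
    and card_lines_in: "h \<in> Pl \<Longrightarrow> card {l \<in> Ln. lies l h} = q\<^sup>2 + q + 1"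
    and card_pencil: "\<lbrakk>P \<in> Pt; h \<in> Pl; l \<in> Ln; on P l; lies l h\<rbrakk>
      \<Longrightarrow> card {m \<in> Ln. on P m \<and> lies m h} = q + 1"
    and card_Ln: "card Ln = (q\<^sup>2 + 1) * (q\<^sup>2 + q + 1)"
    and meet_iff_coplanar: "\<lbrakk>l \<in> Ln; m \<in> Ln\<rbrakk>
      \<Longrightarrow> (\<exists>P\<in>Pt. on P l \<and> on P m) \<longleftrightarrow> (\<exists>h\<in>Pl. lies l h \<and> lies m h)"
    and meet_unique: "\<lbrakk>l \<in> Ln; m \<in> Ln; l \<noteq> m; P \<in> Pt; on P l; on P m; Q \<in> Pt; on Q l; on Q m\<rbrakk>
      \<Longrightarrow> P = Q"
    and join_unique: "\<lbrakk>l \<in> Ln; m \<in> Ln; l \<noteq> m; h \<in> Pl; lies l h; lies m h; k \<in> Pl; lies l k; lies m k\<rbrakk>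
      \<Longrightarrow> h = k"
    and pencil_transversal: "\<lbrakk>P \<in> Pt; h \<in> Pl; l \<in> Ln; on P l; lies l h; m \<in> Ln; \<not> on P m; \<not> lies m h\<rbrakk>
      \<Longrightarrow> \<exists>!k. k \<in> Ln \<and> on P k \<and> lies k h \<and> (\<exists>Q\<in>Pt. on Q m \<and> on Q k)"
    and skew_plane: "\<lbrakk>l \<in> Ln; m \<in> Ln; \<not> (\<exists>Q\<in>Pt. on Q l \<and> on Q m); P \<in> Pt; on P l\<rbrakk>
      \<Longrightarrow> \<exists>!h. h \<in> Pl \<and> lies m h \<and> (\<exists>k\<in>Ln. on P k \<and> lies k h)"
    and skew_point: "\<lbrakk>l \<in> Ln; m \<in> Ln; \<not> (\<exists>Q\<in>Pt. on Q l \<and> on Q m); h \<in> Pl; lies l h\<rbrakk>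
      \<Longrightarrow> \<exists>!P. P \<in> Pt \<and> on P m \<and> (\<exists>k\<in>Ln. on P k \<and> lies k h)"
    and q_pos: "q > 0"
begin

section \<open>Duality and the lines meeting a given line\<close>

definition meets :: "'l \<Rightarrow> 'l \<Rightarrow> bool" where
  "meets l m \<longleftrightarrow> (\<exists>P\<in>Pt. on P l \<and> on P m)"

lemma meets_sym: "meets l m \<longleftrightarrow> meets m l"
  by (auto simp: meets_def)

lemma meets_iff_coplanar:
  "l \<in> Ln \<Longrightarrow> m \<in> Ln \<Longrightarrow> meets l m \<longleftrightarrow> (\<exists>h\<in>Pl. lies l h \<and> lies m h)"
  by (simp add: meets_def meet_iff_coplanar)

text \<open>The axioms are self-dual or come in dual pairs. Where an axiom speaks of two lines with
  a common point, its dual asks for a common plane, and \<open>meet_iff_coplanar\<close> translates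
  between the two.\<close>

lemma dual:
  "projective_3space Pl Ln Pt (\<lambda>h l. lies l h) (\<lambda>l P. on P l) q"
proof (unfold_locales, goal_cases)
  case (6 P) then show ?case by (rule card_lines_in)
next
  case (8 P h l) then show ?case using card_pencil[of h P l] by (simp add: conj_commute)
next
  case (10 l m) then show ?case using meet_iff_coplanar by blast
next
  case (11 l m P Q) then show ?case using join_unique by blast
next
  case (12 l m h k) then show ?case using meet_unique by blast
next
  case (13 P h l m)
  then have "\<exists>!k. k \<in> Ln \<and> on h k \<and> lies k P \<and> meets m k"
    using pencil_transversal[of h P l m] unfolding meets_def by auto
  then show ?case using 13 by (simp add: meets_iff_coplanar conj_ac cong: conj_cong)
next
  case (14 l m P)
  then show ?case using skew_point[of l m P] meet_iff_coplanar[of l m]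
    by (simp add: conj_commute)
next
  case (15 l m h)
  then show ?case using skew_plane[of l m h] meet_iff_coplanar[of l m]
    by (simp add: conj_commute)
qed (use finite_Pt finite_Ln finite_Pl card_points_on card_planes_through card_star card_Ln q_pos
     in auto)

lemma card_common_points:
  assumes "l \<in> Ln" "m \<in> Ln"
  shows "int (card {P \<in> {P \<in> Pt. on P l}. on P m}) =
    (if m = l then int q + 1 else of_bool (meets m l))"
proof (cases "m = l")
  case True
  then show ?thesis using card_points_on[OF assms(1)] by simp
next
  case False
  have "card {P \<in> {P \<in> Pt. on P l}. on P m} = of_bool (meets m l)"
  proof (cases "meets m l")
    case True
    then obtain P where "P \<in> Pt" "on P l" "on P m" by (auto simp: meets_def)
    then have "{P \<in> {P \<in> Pt. on P l}. on P m} = {P}"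
      using meet_unique assms False by blast
    then show ?thesis using True by simp
  next
    case False
    then have "{P \<in> {P \<in> Pt. on P l}. on P m} = {}" by (auto simp: meets_def)
    then show ?thesis using False by (simp only: card.empty of_bool_eq)
  qed
  then show ?thesis using False by simp
qed

text \<open>Each of the \<open>q + 1\<close> points of \<open>m\<close> lies on
  \<open>q^2 + q\<close> further lines, and a line other than \<open>m\<close> is counted at no more
  than one point.\<close>

lemma card_meeting_lines:
  assumes "m \<in> Ln"
  shows "int (card {l \<in> Ln. l \<noteq> m \<and> meets l m}) = (int q + 1) * (int q ^ 2 + int q)"
proof -
  have star: "int (card {l \<in> Ln - {m}. on P l}) = int q ^ 2 + int q"
    if "P \<in> {P \<in> Pt. on P m}" for P
  proof -
    have "{l \<in> Ln. on P l} = insert m {l \<in> Ln - {m}. on P l}" using that assms by auto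
    then have "card {l \<in> Ln. on P l} = Suc (card {l \<in> Ln - {m}. on P l})"
      using finite_Ln by simp
    then show ?thesis using card_star[of P] that by simp
  qed
  have "{l \<in> Ln. l \<noteq> m \<and> meets l m} = {l \<in> Ln - {m}. meets l m}" by auto
  then have "int (card {l \<in> Ln. l \<noteq> m \<and> meets l m}) = (\<Sum>l\<in>Ln - {m}. of_bool (meets l m))"
    using int_card_filter_eq_sum[of "Ln - {m}" "\<lambda>l. meets l m"] finite_Ln by simp
  also have "\<dots> = (\<Sum>l\<in>Ln - {m}. int (card {P \<in> {P \<in> Pt. on P m}. on P l}))"
    by (rule sum.cong) (use card_common_points assms in auto)
  also have "\<dots> = (\<Sum>P\<in>{P \<in> Pt. on P m}. int (card {l \<in> Ln - {m}. on P l}))"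
    by (rule sum_card_filter_swap) (use finite_Ln finite_Pt in auto)
  also have "\<dots> = (\<Sum>P\<in>{P \<in> Pt. on P m}. int q ^ 2 + int q)"
    by (rule sum.cong) (use star in auto)
  also have "\<dots> = (int q + 1) * (int q ^ 2 + int q)"
    using card_points_on[OF assms] by simp
  finally show ?thesis .
qed

end

section \<open>Counting identities for a Cameron-Liebler line class\<close>

locale cameron_liebler_class = projective_3space +
  fixes L :: "'b set" and x :: int
  assumes L_subset: "L \<subseteq> Ln"
    and card_meeting: "l \<in> Ln \<Longrightarrow> int (card {m \<in> L. m \<noteq> l \<and> meets m l}) =
      (int q + 1) * x + ((int q)\<^sup>2 - 1) * of_bool (l \<in> L)"
begin

lemma finite_L: "finite L"
  using L_subset finite_Ln finite_subset by blast

text \<open>The defining condition involves only the meeting relation, which is the same in the dual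
  space because two lines meet iff they are coplanar.\<close>

lemma dual_class:
  "cameron_liebler_class Pl Ln Pt (\<lambda>h l. lies l h) (\<lambda>l P. on P l) q L x"
proof -
  interpret dual: projective_3space Pl Ln Pt "\<lambda>h l. lies l h" "\<lambda>l P. on P l" q
    by (rule dual)
  have "dual.meets m l \<longleftrightarrow> meets m l" if "m \<in> Ln" "l \<in> Ln" for m l
    using that by (simp add: dual.meets_def meets_iff_coplanar)
  then have "{m \<in> L. m \<noteq> l \<and> dual.meets m l} = {m \<in> L. m \<noteq> l \<and> meets m l}" if "l \<in> Ln" for l
    using that L_subset by blast
  then show ?thesis
    by unfold_locales (use L_subset card_meeting in auto)
qed

definition s where "s P = int (card {l \<in> L. on P l})"
definition p where "p h = int (card {l \<in> L. lies l h})"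
definition c where "c P h = int (card {l \<in> L. on P l \<and> lies l h})"
definition chi :: "'b \<Rightarrow> int" where "chi l = of_bool (l \<in> L)"

text \<open>Summing the defining condition over all lines counts the meeting pairs of a line and a
  line of the class. Counted from the side of the class, the sum is \<open>card L\<close> times the
  number of lines meeting a fixed line. The factor \<open>(q + 1) * (q^2 + 1)\<close>
  cancels.\<close>

lemma card_L: "int (card L) = x * (int q ^ 2 + int q + 1)"
proof -
  let ?q = "int q"
  have "(\<Sum>l\<in>Ln. int (card {m \<in> L. m \<noteq> l \<and> meets m l})) =
        (\<Sum>m\<in>L. int (card {l \<in> Ln. m \<noteq> l \<and> meets m l}))"
    by (rule sum_card_filter_swap) (use finite_L finite_Ln in auto)
  also have "\<dots> = (\<Sum>m\<in>L. (?q + 1) * (?q ^ 2 + ?q))"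
  proof (rule sum.cong)
    fix m assume "m \<in> L"
    moreover have "{l \<in> Ln. m \<noteq> l \<and> meets m l} = {l \<in> Ln. l \<noteq> m \<and> meets l m}"
      using meets_sym by auto
    ultimately show "int (card {l \<in> Ln. m \<noteq> l \<and> meets m l}) = (?q + 1) * (?q ^ 2 + ?q)"
      using card_meeting_lines[of m] L_subset by auto
  qed simp
  also have "\<dots> = int (card L) * ((?q + 1) * (?q ^ 2 + ?q))" by simp
  finally have 1: "(\<Sum>l\<in>Ln. int (card {m \<in> L. m \<noteq> l \<and> meets m l})) = 
      int (card L) * ((?q + 1) * (?q ^ 2 + ?q))" .
  have "(\<Sum>l\<in>Ln. int (card {m \<in> L. m \<noteq> l \<and> meets m l})) =
      (\<Sum>l\<in>Ln. (?q + 1) * x + (?q ^ 2 - 1) * of_bool (l \<in> L))"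
    by (rule sum.cong) (use card_meeting in auto)
  also have "\<dots> = int (card Ln) * ((?q + 1) * x) + (?q ^ 2 - 1) * (\<Sum>l\<in>Ln. of_bool (l \<in> L))"
    by (simp add: sum.distrib sum_distrib_left)
  also have "(\<Sum>l\<in>Ln. of_bool (l \<in> L)) = int (card L)"
    using finite_Ln L_subset by (simp add: sum_of_bool_eq Int_absorb2 Int_commute)
  finally have "int (card L) * ((?q + 1) * (?q ^ 2 + ?q)) =
      int (card Ln) * ((?q + 1) * x) + (?q ^ 2 - 1) * int (card L)"
    using 1 by simp
  then have "int (card L) * ((?q + 1) * (?q ^ 2 + ?q)) =
      (?q ^ 2 + 1) * (?q ^ 2 + ?q + 1) * ((?q + 1) * x) + (?q ^ 2 - 1) * int (card L)"
    by (simp only: card_Ln of_nat_mult of_nat_add of_nat_power of_nat_1)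
  then have "(?q + 1) * (?q ^ 2 + 1) * int (card L) =
      (?q + 1) * (?q ^ 2 + 1) * (x * (?q ^ 2 + ?q + 1))"
    by algebra
  moreover have "?q + 1 > 0" "?q ^ 2 + 1 > 0" by (simp_all add: add_nonneg_pos)
  ultimately show ?thesis by simp
qed

text \<open>Each line of the class that meets \<open>l\<close> in one point contributes 1, and
  \<open>l\<close> itself, if it belongs to the class, contributes \<open>q + 1\<close>. The first
  contribution is given by the defining condition.\<close>

lemma sum_s:
  assumes "l \<in> Ln"
  shows "(\<Sum>P\<in>{P \<in> Pt. on P l}. s P) = (int q + 1) * x + (int q ^ 2 + int q) * chi l"
proof -
  have "(\<Sum>P\<in>{P \<in> Pt. on P l}. s P) = (\<Sum>m\<in>L. int (card {P \<in> {P \<in> Pt. on P l}. on P m}))"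
    unfolding s_def by (rule sum_card_filter_swap) (use finite_Pt finite_L in auto)
  also have "\<dots> = (\<Sum>m\<in>L. of_bool (m \<noteq> l \<and> meets m l) + (int q + 1) * of_bool (m = l))"
    by (rule sum.cong) (use card_common_points[OF assms] L_subset in \<open>auto simp: subset_iff\<close>)
  also have "\<dots> = int (card {m \<in> L. m \<noteq> l \<and> meets m l}) + (int q + 1) * chi l"
    using finite_L
    by (simp add: sum.distrib int_card_filter_eq_sum sum_distrib_left[symmetric] chi_def sum_of_bool_eq of_bool_def)
  also have "\<dots> = (int q + 1) * x + (int q ^ 2 + int q) * chi l"
    using card_meeting[OF assms] by (simp add: chi_def algebra_simps)
  finally show ?thesis .
qed

lemma sum_p:
  assumes "l \<in> Ln"
  shows "(\<Sum>h\<in>{h \<in> Pl. lies l h}. p h) = (int q + 1) * x + (int q ^ 2 + int q) * chi l"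
proof -
  interpret dual: cameron_liebler_class Pl Ln Pt "\<lambda>h l. lies l h" "\<lambda>l P. on P l" q L x
    by (rule dual_class)
  show ?thesis using dual.sum_s[OF assms] by (simp add: dual.s_def p_def dual.chi_def chi_def)
qed

text \<open>The defining condition is summed over the \<open>q + 1\<close> lines of the pencil of
  \<open>P\<close> and \<open>h\<close>. How many of them a line of the class meets depends only on
  whether it passes through \<open>P\<close> and whether it lies in \<open>h\<close>.\<close>

lemma flag:
  assumes "P \<in> Pt" "h \<in> Pl" "l \<in> Ln" "on P l" "lies l h"
  shows "s P + p h = x + (int q + 1) * c P h"
proof -
  let ?q = "int q" and ?F = "{l \<in> Ln. on P l \<and> lies l h}"
  have F: "card ?F = q + 1" using card_pencil[OF assms] .
  have finF: "finite ?F" using finite_Ln by simp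
  \<comment> \<open>A line through \<open>P\<close> or in \<open>h\<close> meets every pencil line,
    any other line exactly one. The last term corrects for a line \<open>m\<close> of the pencil
    itself, which leaves \<open>q\<close> lines other than \<open>m\<close>.\<close>
  have one: "int (card {k \<in> ?F. m \<noteq> k \<and> meets m k}) =
      1 + ?q * of_bool (on P m) + ?q * of_bool (lies m h) - (?q + 1) * of_bool (on P m \<and> lies m h)"
    if "m \<in> L" for m
  proof -
    have m: "m \<in> Ln" using that L_subset by auto
    consider "on P m" "lies m h" | "on P m" "\<not> lies m h" | "\<not> on P m" "lies m h"
      | "\<not> on P m" "\<not> lies m h" by blast
    then show ?thesis
    proof cases
      case 1
      then have "{k \<in> ?F. m \<noteq> k \<and> meets m k} = ?F - {m}" using assms by (auto simp: meets_def)
      then show ?thesis using 1 m F by simp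
    next
      case 2
      then have "{k \<in> ?F. m \<noteq> k \<and> meets m k} = ?F" using assms by (auto simp: meets_def)
      then show ?thesis using 2 F by simp
    next
      case 3
      then have "{k \<in> ?F. m \<noteq> k \<and> meets m k} = ?F" using assms m by (auto simp: meets_iff_coplanar)
      then show ?thesis using 3 F by simp
    next
      case 4
      have "card {k \<in> Ln. on P k \<and> lies k h \<and> meets m k} = 1"
        unfolding card_eq_1_iff_Ex1 meets_def
        using pencil_transversal[OF assms m 4] by simp
      moreover have "{k \<in> ?F. m \<noteq> k \<and> meets m k} = {k \<in> Ln. on P k \<and> lies k h \<and> meets m k}"
        using 4 by auto
      ultimately show ?thesis using 4 by simp
    qed
  qed
  have "(\<Sum>k\<in>?F. int (card {m \<in> L. m \<noteq> k \<and> meets m k})) =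
      (\<Sum>m\<in>L. int (card {k \<in> ?F. m \<noteq> k \<and> meets m k}))"
    by (rule sum_card_filter_swap) (use finite_L finF in auto)
  also have "\<dots> = (\<Sum>m\<in>L. 1 + ?q * of_bool (on P m) + ?q * of_bool (lies m h)
      - (?q + 1) * of_bool (on P m \<and> lies m h))"
    by (rule sum.cong) (use one in auto)
  also have "\<dots> = int (card L) + ?q * s P + ?q * p h - (?q + 1) * c P h"
    unfolding s_def p_def c_def
    by (simp only: int_card_filter_eq_sum[OF finite_L] sum.distrib sum_subtractf sum_distrib_left[symmetric])
      simp
  finally have "int (card L) + ?q * s P + ?q * p h - (?q + 1) * c P h =
      (\<Sum>k\<in>?F. int (card {m \<in> L. m \<noteq> k \<and> meets m k}))" by simp
  also have "\<dots> = (\<Sum>k\<in>?F. (?q + 1) * x + (?q ^ 2 - 1) * of_bool (k \<in> L))"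
    by (rule sum.cong) (use card_meeting in auto)
  also have "\<dots> = (?q + 1) * ((?q + 1) * x) + (?q ^ 2 - 1) * (\<Sum>k\<in>?F. of_bool (k \<in> L))"
    using F by (simp add: sum.distrib sum_distrib_left)
  also have "(\<Sum>k\<in>?F. of_bool (k \<in> L)) = c P h"
  proof -
    have "{k \<in> ?F. k \<in> L} = {k \<in> L. on P k \<and> lies k h}" using L_subset by auto
    then show ?thesis using int_card_filter_eq_sum[OF finF, of "\<lambda>k. k \<in> L"] by (simp add: c_def)
  qed
  finally have "?q * (s P + p h) = ?q * (x + (?q + 1) * c P h)"
    unfolding card_L by algebra
  then show ?thesis using q_pos by simp
qed

text \<open>Sending a point \<open>P\<close> of \<open>l\<close> to the plane spanned by
  \<open>P\<close> and \<open>m\<close> is a bijection onto the planes through \<open>m\<close>. The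
  transversals through \<open>P\<close> are the lines of the corresponding pencil, so
  \<open>flag\<close>, summed over the points of \<open>l\<close>, counts all transversals in the
  class.\<close>

lemma skew_transversals:
  assumes "l \<in> Ln" "m \<in> Ln" "\<not> meets l m"
  shows "int (card {t \<in> L. meets t l \<and> meets t m}) = x + int q * (chi l + chi m)"
proof -
  let ?q = "int q" and ?A = "{P \<in> Pt. on P l}" and ?B = "{h \<in> Pl. lies m h}"
  \<comment> \<open>\<open>f P\<close> is the plane spanned by \<open>P\<close> and
    \<open>m\<close>. That it contains \<open>P\<close> is stated through a line \<open>k\<close>
    between them.\<close>
  define f where "f P = (THE h. h \<in> Pl \<and> lies m h \<and> (\<exists>k\<in>Ln. on P k \<and> lies k h))" for P
  have ex: "\<exists>!h. h \<in> Pl \<and> lies m h \<and> (\<exists>k\<in>Ln. on P k \<and> lies k h)" if "P \<in> ?A" for P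
    using skew_plane[of l m P] assms that by (simp add: meets_def)
  have f: "f P \<in> Pl" "lies m (f P)" "\<exists>k\<in>Ln. on P k \<and> lies k (f P)" if "P \<in> ?A" for P
    using theI'[OF ex[OF that]] unfolding f_def by auto
  have f_eq: "f P = h" if "P \<in> ?A" "h \<in> Pl" "lies m h" "k \<in> Ln" "on P k" "lies k h" for P h k
    using the1_equality[OF ex[OF that(1)], of h] that unfolding f_def by blast
  \<comment> \<open>The inverse of \<open>f\<close> sends a plane through \<open>m\<close> to its
    unique point on \<open>l\<close>.\<close>
  have ex': "\<exists>!P. P \<in> Pt \<and> on P l \<and> (\<exists>k\<in>Ln. on P k \<and> lies k h)" if "h \<in> ?B" for h
    using skew_point[of m l h] assms that by (auto simp: meets_def)
  have "bij_betw f ?A ?B"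
  proof (rule bij_betwI')
    fix P Q assume PQ: "P \<in> ?A" "Q \<in> ?A"
    show "(f P = f Q) = (P = Q)"
    proof
      assume "f P = f Q"
      then show "P = Q"
        using ex'[of "f P"] f[OF PQ(1)] f[OF PQ(2)] PQ unfolding Ex1_def by simp metis
    qed simp
  next
    fix P assume "P \<in> ?A" then show "f P \<in> ?B" using f by blast
  next
    fix h assume h: "h \<in> ?B"
    from ex'[OF h] obtain P k where Pk: "P \<in> ?A" "k \<in> Ln" "on P k" "lies k h"
      unfolding Ex1_def by auto
    then have "f P = h" using f_eq[OF Pk(1) _ _ Pk(2-4)] h by simp
    then show "\<exists>P\<in>?A. h = f P" using Pk(1) by blast
  qed
  then have sum_pf: "(\<Sum>P\<in>?A. p (f P)) = (\<Sum>h\<in>?B. p h)"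
    by (rule sum.reindex_bij_betw)
  have one: "int (card {P \<in> ?A. on P t \<and> lies t (f P)}) = of_bool (meets t l \<and> meets t m)"
    if "t \<in> L" for t
  proof (cases "meets t l \<and> meets t m")
    case True
    have t: "t \<in> Ln" using that L_subset by auto
    obtain P where P: "P \<in> ?A" "on P t" using True by (auto simp: meets_def)
    obtain h where h: "h \<in> Pl" "lies t h" "lies m h"
      using True meets_iff_coplanar[OF t assms(2)] by auto
    have "t \<noteq> l" using True assms by auto
    have "f P = h" using f_eq[OF P(1) h(1,3) t P(2) h(2)] .
    moreover have "Q = P" if "Q \<in> ?A" "on Q t" for Q
      using meet_unique[OF t assms(1) \<open>t \<noteq> l\<close>, of Q P] P that by simp
    ultimately have "{P \<in> ?A. on P t \<and> lies t (f P)} = {P}"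
      using P h(2) by blast
    then show ?thesis using True by simp
  next
    case False
    have "meets t l \<and> meets t m" if "P \<in> ?A" "on P t" "lies t (f P)" for P
    proof -
      have "t \<in> Ln" using \<open>t \<in> L\<close> L_subset by auto
      then have "meets t m" using f(1,2)[OF that(1)] that(3) meets_iff_coplanar[of t m] assms by auto
      moreover have "meets t l" using that by (auto simp: meets_def)
      ultimately show ?thesis by simp
    qed
    then have "{P \<in> ?A. on P t \<and> lies t (f P)} = {}" using False by blast
    then show ?thesis using False by (simp only: card.empty of_nat_0 of_bool_eq)
  qed
  have "(\<Sum>P\<in>?A. c P (f P)) = (\<Sum>t\<in>L. int (card {P \<in> ?A. on P t \<and> lies t (f P)}))"
    unfolding c_def by (rule sum_card_filter_swap) (use finite_Pt finite_L in auto)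
  also have "\<dots> = (\<Sum>t\<in>L. of_bool (meets t l \<and> meets t m))"
    by (rule sum.cong) (use one in auto)
  also have "\<dots> = int (card {t \<in> L. meets t l \<and> meets t m})"
    by (rule int_card_filter_eq_sum[OF finite_L, symmetric])
  finally have cards: "(\<Sum>P\<in>?A. c P (f P)) = int (card {t \<in> L. meets t l \<and> meets t m})" .
  have "(\<Sum>P\<in>?A. s P + p (f P)) = (\<Sum>P\<in>?A. x + (?q + 1) * c P (f P))"
  proof (rule sum.cong)
    fix P assume P: "P \<in> ?A"
    obtain k where "k \<in> Ln" "on P k" "lies k (f P)" using f[OF P] by auto
    then show "s P + p (f P) = x + (?q + 1) * c P (f P)"
      using flag[of P "f P" k] P f[OF P] by auto
  qed simp
  then have "(\<Sum>P\<in>?A. s P) + (\<Sum>P\<in>?A. p (f P)) = (?q + 1) * x + (?q + 1) * (\<Sum>P\<in>?A. c P (f P))"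
    using card_points_on[OF assms(1)] by (simp add: sum.distrib sum_distrib_left)
  then have "(?q + 1) * int (card {t \<in> L. meets t l \<and> meets t m}) =
     (?q + 1) * (x + ?q * (chi l + chi m))"
    unfolding cards sum_pf sum_s[OF assms(1)] sum_p[OF assms(2)]
    by (simp add: algebra_simps power2_eq_square)
  then show ?thesis by (rule mult_left_cancel[THEN iffD1, rotated]) simp
qed

text \<open>Let \<open>M\<close> be the set of lines of the class that meet \<open>l\<close>, other
  than \<open>l\<close>. The number of meeting pairs from \<open>M\<close> and the class is known
  from the defining condition. Counted by the other member \<open>m'\<close>, it splits into the
  cases \<open>m' = l\<close>, \<open>m'\<close> skew to \<open>l\<close>, where
  \<open>skew_transversals\<close> applies, and \<open>m'\<close> in \<open>M\<close>. The last case
  brings in \<open>s P\<close> and \<open>p h\<close> for the point and plane common to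
  \<open>m'\<close> and \<open>l\<close>, each taken about \<open>s P\<close> or \<open>p h\<close>
  times, which produces the squares.\<close>

lemma sum_squares:
  assumes l: "l \<in> Ln"
  shows "(\<Sum>P\<in>{P \<in> Pt. on P l}. (s P)\<^sup>2) + (\<Sum>h\<in>{h \<in> Pl. lies l h}. (p h)\<^sup>2) =
    (int q + 1) * (2 * x\<^sup>2 + int q * x + chi l * (2 * int q * x + int q * (int q + 1)\<^sup>2))"
proof -
  let ?q = "int q" and ?A = "{P \<in> Pt. on P l}" and ?B = "{h \<in> Pl. lies l h}"
  let ?M = "{m \<in> L. m \<noteq> l \<and> meets m l}"
  let ?S = "\<Sum>P\<in>?A. (s P)\<^sup>2" and ?T = "\<Sum>h\<in>?B. (p h)\<^sup>2"
  define N where "N m' = int (card {m \<in> ?M. m' \<noteq> m \<and> meets m' m})" for m'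
  have finM: "finite ?M" using finite_L by simp
  have finA: "finite ?A" and finB: "finite ?B" using finite_Pt finite_Pl by simp_all
  have M: "int (card ?M) = (?q + 1) * x + (?q\<^sup>2 - 1) * chi l"
    using card_meeting[OF l] by (simp add: chi_def)
  have chi: "chi l * chi l = chi l" by (simp add: chi_def)
  have M_common: "\<exists>P h. P \<in> Pt \<and> on P m \<and> h \<in> Pl \<and> lies m h \<and> {P \<in> ?A. on P m} = {P} \<and> {h \<in> ?B. lies m h} = {h}"
    if "m \<in> ?M" for m
  proof -
    have m: "m \<in> Ln" "m \<noteq> l" "meets m l" using that L_subset by auto
    obtain P where P: "P \<in> Pt" "on P m" "on P l" using m by (auto simp: meets_def)
    obtain h where h: "h \<in> Pl" "lies m h" "lies l h" using m l by (auto simp: meets_iff_coplanar)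
    have "{P \<in> ?A. on P m} = {P}" using P meet_unique[OF m(1) l m(2)] by blast
    moreover have "{h \<in> ?B. lies m h} = {h}" using h join_unique[OF m(1) l m(2)] by blast
    ultimately show ?thesis using P h by blast
  qed

  have N_self: "N l = int (card ?M)"
    unfolding N_def by (rule arg_cong[where f = "\<lambda>A. int (card A)"]) (auto simp: meets_sym)

  have N_skew: "N m' = x + ?q * (1 + chi l)" if "m' \<in> L" "m' \<noteq> l" "\<not> meets m' l" for m'
  proof -
    have m': "m' \<in> Ln" using that L_subset by auto
    have "{m \<in> ?M. m' \<noteq> m \<and> meets m' m} = {t \<in> L. meets t m' \<and> meets t l}"
      using that by (auto simp: meets_sym)
    then show ?thesis
      using skew_transversals[OF m' l that(3)] that(1) unfolding N_def by (simp add: chi_def)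
  qed

  \<comment> \<open>Both inner sums have a single term, the common point and the common plane of
    \<open>m\<close> and \<open>l\<close>. Writing them as sums allows the summation order to be
    exchanged later. The count \<open>c P h\<close> has been eliminated by
    \<open>flag\<close>.\<close>
  have N_meet: "(?q + 1) * N m = ?q * ((\<Sum>P\<in>{P \<in> ?A. on P m}. s P) + (\<Sum>h\<in>{h \<in> ?B. lies m h}. p h))
      + (x - (?q + 1) * (1 + chi l))"
    if m: "m \<in> ?M" for m
  proof -
    obtain P h where P: "P \<in> Pt" "on P m" "{P \<in> ?A. on P m} = {P}"
      and h: "h \<in> Pl" "lies m h" "{h \<in> ?B. lies m h} = {h}"
      using M_common[OF m] by blast
    have mLn: "m \<in> Ln" "m \<noteq> l" "m \<in> L" using m L_subset by auto
    have Pl: "on P l" and hl: "lies l h" using P h by auto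
    let ?U = "{k \<in> L. on P k} \<union> {k \<in> L. lies k h}"
    have U: "{k \<in> ?M. m \<noteq> k \<and> meets m k} = ?U - {m} - {l}"
    proof (intro equalityI subsetI)
      fix k assume "k \<in> {k \<in> ?M. m \<noteq> k \<and> meets m k}"
      then have k: "k \<in> L" "k \<in> Ln" "k \<noteq> l" "meets k l" "m \<noteq> k" "meets m k"
        using L_subset by auto
      \<comment> \<open>Otherwise \<open>k\<close> would meet two lines, \<open>l\<close> and
        \<open>m\<close>, of the pencil of \<open>P\<close> and \<open>h\<close>, contrary to
        \<open>pencil_transversal\<close>.\<close>
      have "on P k \<or> lies k h"
      proof (rule ccontr)
        assume "\<not> (on P k \<or> lies k h)"
        then have "\<exists>!t. t \<in> Ln \<and> on P t \<and> lies t h \<and> meets k t"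
          unfolding meets_def using pencil_transversal[OF P(1) h(1) l Pl hl k(2)] by blast
        moreover have "meets k m" using k(6) meets_sym by blast
        ultimately show False using l Pl hl k(4) mLn(1,2) P(2) h(2) by blast
      qed
      then show "k \<in> ?U - {m} - {l}" using k by auto
    next
      fix k assume "k \<in> ?U - {m} - {l}"
      then have k: "k \<in> L" "k \<in> Ln" "k \<noteq> m" "k \<noteq> l" "on P k \<or> lies k h" using L_subset by auto
      then have "meets k l" "meets m k"
        using P(1,2) Pl h(1,2) hl meets_iff_coplanar[OF k(2) l] meets_iff_coplanar[OF mLn(1) k(2)]
        unfolding meets_def by blast+
      then show "k \<in> {k \<in> ?M. m \<noteq> k \<and> meets m k}" using k by auto
    qed
    have "card ?U + card ({k \<in> L. on P k} \<inter> {k \<in> L. lies k h}) = card {k \<in> L. on P k} + card {k \<in> L. lies k h}"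
      by (rule card_Un_Int[symmetric]) (use finite_L in simp_all)
    moreover have "{k \<in> L. on P k} \<inter> {k \<in> L. lies k h} = {k \<in> L. on P k \<and> lies k h}" by auto
    ultimately have cU: "int (card ?U) = s P + p h - c P h"
      unfolding s_def p_def c_def by simp
    have "N m = int (card (?U - {m} - {l}))" unfolding N_def U by simp
    also have "\<dots> = int (card ?U) - of_bool (m \<in> ?U) - of_bool (l \<in> ?U - {m})"
      by (subst int_card_remove, simp add: finite_L, subst int_card_remove) (simp_all add: finite_L)
    also have "\<dots> = int (card ?U) - 1 - chi l"
      using mLn P(2) Pl by (simp add: chi_def)
    finally have "N m = s P + p h - c P h - 1 - chi l" unfolding cU .
    moreover have "s P + p h = x + (?q + 1) * c P h"
      using flag[OF P(1) h(1) l Pl hl] .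
    ultimately have "(?q + 1) * N m = ?q * (s P + p h) + (x - (?q + 1) * (1 + chi l))"
      by algebra
    then show ?thesis unfolding P(3) h(3) by simp
  qed

  \<comment> \<open>The term \<open>s P\<close> occurs once for each line of \<open>?M\<close>
    through \<open>P\<close>, and there are \<open>s P - chi l\<close> of them, since
    \<open>l\<close> is left out of \<open>?M\<close>.\<close>
  have sum_sA: "(\<Sum>m\<in>?M. \<Sum>P\<in>{P \<in> ?A. on P m}. s P) = ?S - chi l * (\<Sum>P\<in>?A. s P)"
  proof -
    have "(\<Sum>m\<in>?M. \<Sum>P\<in>{P \<in> ?A. on P m}. s P) = (\<Sum>P\<in>?A. \<Sum>m\<in>{m \<in> ?M. on P m}. s P)"
      by (rule sum.swap_restrict[OF finM finA])
    also have "\<dots> = (\<Sum>P\<in>?A. (s P)\<^sup>2 - chi l * s P)"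
    proof (rule sum.cong)
      fix P assume P: "P \<in> ?A"
      have "{m \<in> ?M. on P m} = {m \<in> L. on P m} - {l}" using P by (auto simp: meets_def)
      then have "int (card {m \<in> ?M. on P m}) = s P - chi l"
        using P int_card_remove[of "{m \<in> L. on P m}" l] finite_L by (simp add: s_def chi_def)
      then show "(\<Sum>m\<in>{m \<in> ?M. on P m}. s P) = (s P)\<^sup>2 - chi l * s P"
        by (simp only: sum_constant) (simp add: power2_eq_square left_diff_distrib)
    qed simp
    finally show ?thesis by (simp add: sum_subtractf sum_distrib_left)
  qed
  have sum_pB: "(\<Sum>m\<in>?M. \<Sum>h\<in>{h \<in> ?B. lies m h}. p h) = ?T - chi l * (\<Sum>h\<in>?B. p h)"
  proof -
    have "(\<Sum>m\<in>?M. \<Sum>h\<in>{h \<in> ?B. lies m h}. p h) = (\<Sum>h\<in>?B. \<Sum>m\<in>{m \<in> ?M. lies m h}. p h)"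
      by (rule sum.swap_restrict[OF finM finB])
    also have "\<dots> = (\<Sum>h\<in>?B. (p h)\<^sup>2 - chi l * p h)"
    proof (rule sum.cong)
      fix h assume h: "h \<in> ?B"
      have "{m \<in> ?M. lies m h} = {m \<in> L. lies m h} - {l}" using h l L_subset by (auto simp: meets_iff_coplanar subset_iff)
      then have "int (card {m \<in> ?M. lies m h}) = p h - chi l"
        using h int_card_remove[of "{m \<in> L. lies m h}" l] finite_L by (simp add: p_def chi_def)
      then show "(\<Sum>m\<in>{m \<in> ?M. lies m h}. p h) = (p h)\<^sup>2 - chi l * p h"
        by (simp only: sum_constant) (simp add: power2_eq_square left_diff_distrib)
    qed simp
    finally show ?thesis by (simp add: sum_subtractf sum_distrib_left)
  qed

  \<comment> \<open>Count the pairs of meeting lines \<open>m \<in> ?M\<close>, \<open>m' \<in> L\<close> in two ways.\<close>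
  have "(\<Sum>m\<in>?M. int (card {m' \<in> L. m' \<noteq> m \<and> meets m' m})) = (\<Sum>m'\<in>L. N m')"
    unfolding N_def by (rule sum_card_filter_swap) (use finite_L finM in auto)
  moreover have "(\<Sum>m\<in>?M. int (card {m' \<in> L. m' \<noteq> m \<and> meets m' m})) =
      (\<Sum>m\<in>?M. (?q + 1) * x + (?q\<^sup>2 - 1))"
    by (rule sum.cong) (use card_meeting L_subset in \<open>auto simp: subset_iff\<close>)
  ultimately have total: "int (card ?M) * ((?q + 1) * x + (?q\<^sup>2 - 1)) = (\<Sum>m'\<in>L. N m')"
    by simp

  \<comment> \<open>The class is split into \<open>l\<close> itself (if it belongs), the lines skew
    to \<open>l\<close>, and \<open>?M\<close>.\<close>
  let ?R = "{m \<in> L. m \<noteq> l \<and> \<not> meets m l}" and ?I = "{m \<in> L. m = l}"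
  have parts: "L = ?I \<union> (?R \<union> ?M)" "?I \<inter> (?R \<union> ?M) = {}" "?R \<inter> ?M = {}" by auto
  have sum_split: "(\<Sum>m'\<in>L. f m') = (\<Sum>m'\<in>?I. f m') + (\<Sum>m'\<in>?R. f m') + (\<Sum>m'\<in>?M. f m')"
    for f :: "_ \<Rightarrow> int"
    by (subst parts(1), subst sum.union_disjoint[OF _ _ parts(2)])
      (use finite_L parts(3) in \<open>simp_all add: sum.union_disjoint\<close>)
  have I: "(\<Sum>m'\<in>?I. f m') = chi l * f l" for f :: "_ \<Rightarrow> int"
  proof (cases "l \<in> L")
    case True
    then have "?I = {l}" by auto
    then show ?thesis using True by (simp add: chi_def)
  next
    case False
    then have I0: "?I = {}" by auto
    show ?thesis unfolding I0 using False by (simp add: chi_def)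
  qed
  have R: "int (card ?R) = x * (?q\<^sup>2 + ?q + 1) - chi l - int (card ?M)"
    using sum_split[of "\<lambda>_. 1"] I[of "\<lambda>_. 1"] card_L by simp
  have "(\<Sum>m'\<in>?R. N m') = (\<Sum>m'\<in>?R. x + ?q * (1 + chi l))"
    by (rule sum.cong) (use N_skew in auto)
  then have "(\<Sum>m'\<in>?M. N m') = int (card ?M) * ((?q + 1) * x + (?q\<^sup>2 - 1)) - chi l * int (card ?M)
      - int (card ?R) * (x + ?q * (1 + chi l))"
    using total sum_split[of N] I[of N] N_self by simp
  moreover have "(?q + 1) * (\<Sum>m'\<in>?M. N m') =
      ?q * (?S - chi l * (\<Sum>P\<in>?A. s P) + (?T - chi l * (\<Sum>h\<in>?B. p h)))
      + int (card ?M) * (x - (?q + 1) * (1 + chi l))"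
  proof -
    have "(?q + 1) * (\<Sum>m'\<in>?M. N m') = (\<Sum>m\<in>?M. ?q * ((\<Sum>P\<in>{P \<in> ?A. on P m}. s P) +
        (\<Sum>h\<in>{h \<in> ?B. lies m h}. p h)) + (x - (?q + 1) * (1 + chi l)))"
      unfolding sum_distrib_left by (rule sum.cong) (use N_meet in auto)
    then show ?thesis
      by (simp only: sum.distrib sum_distrib_left[symmetric] sum_sA sum_pB sum_constant)
  qed
  ultimately have "?q * (?S + ?T) = ?q * ((?q + 1) *
      (2 * x\<^sup>2 + ?q * x + chi l * (2 * ?q * x + ?q * (?q + 1)\<^sup>2)))"
    unfolding R M sum_s[OF l] sum_p[OF l] using chi by algebra
  then show ?thesis using q_pos by simp
qed

end

section \<open>The values on a line for \<open>q = 4\<close>\<close>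

text \<open>Here \<open>n k\<close> and \<open>d k\<close> stand for the number of points of value \<open>a + 5 * k\<close> and planes of value
  \<open>b + 5 * k\<close> on a line, and \<open>e\<close> is 1 or 0 according to whether the line belongs to the class.\<close>

definition admissible :: "int \<Rightarrow> int \<Rightarrow> int \<Rightarrow> int \<Rightarrow> (nat \<Rightarrow> int) \<Rightarrow> (nat \<Rightarrow> int) \<Rightarrow> bool" where
  "admissible x e a b n d \<longleftrightarrow>
    (\<forall>k<5. 0 \<le> n k \<and> 0 \<le> d k) \<and> (\<Sum>k<5. n k) = 5 \<and> (\<Sum>k<5. d k) = 5 \<and>
    (\<Sum>k<5. int k * n k) = x + 4 * e - a \<and> (\<Sum>k<5. int k * d k) = x + 4 * e - b \<and>
    5 * ((\<Sum>k<5. (int k)\<^sup>2 * n k) + (\<Sum>k<5. (int k)\<^sup>2 * d k)) =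
      2 * x\<^sup>2 + 4 * x + e * (8 * x + 100) - a * (2 * x + 8 * e - a) - b * (2 * x + 8 * e - b) \<and>
    (\<forall>j<5. \<forall>k<5. 0 < n j \<and> 0 < d k \<longrightarrow>
      x + 5 * e \<le> a + b + 5 * int (j + k) \<and> a + b + 5 * int (j + k) \<le> x + 25)"

section \<open>Solutions of the moment equations for \<open>x\<close> in 4, 5, 6, 8\<close>

lemma lessThan_5: "{..<5::nat} = {0, 1, 2, 3, 4}"
  by auto

lemma all_less_5: "(\<forall>k<5::nat. Q k) \<longleftrightarrow> Q 0 \<and> Q 1 \<and> Q 2 \<and> Q 3 \<and> Q 4"
  using lessThan_5 by (auto simp: set_eq_iff)

text \<open>The right-hand side of the equation for the second moments must be divisible by 5. As
  \<open>b\<close> is determined by \<open>a\<close>, only five residues have to be tested.\<close>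

lemma admissible_residues:
  assumes "admissible x e a b n d" "a \<in> {0..<5}" "b \<in> {0..<5}" "(a + b) mod 5 = x mod 5"
    and "e = 0 \<or> e = 1"
  shows "x = 4 \<Longrightarrow> e = 1" "x = 8 \<Longrightarrow> e = 1" "x = 5 \<Longrightarrow> a = 0 \<and> b = 0"
    and "x = 6 \<Longrightarrow> a = 0 \<and> b = 1 \<or> a = 1 \<and> b = 0"
proof -
  have a: "a = 0 \<or> a = 1 \<or> a = 2 \<or> a = 3 \<or> a = 4" using assms(2) by auto
  obtain E where E: "5 * E =
      2 * x\<^sup>2 + 4 * x + e * (8 * x + 100) - a * (2 * x + 8 * e - a) - b * (2 * x + 8 * e - b)"
    using assms(1) unfolding admissible_def by blast
  have b: "b = (x - a) mod 5"
    using assms(3,4) by (metis add_diff_cancel_left' atLeastLessThan_iff mod_diff_left_eq mod_pos_pos_trivial)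
  show "e = 1" if "x = 4" using assms(5) a E b that by (elim disjE) (simp_all, arith+)
  show "e = 1" if "x = 8" using assms(5) a E b that by (elim disjE) (simp_all, arith+)
  show "a = 0 \<and> b = 0" if "x = 5" using assms(5) a E b that by (elim disjE) (simp_all, arith+)
  show "a = 0 \<and> b = 1 \<or> a = 1 \<and> b = 0" if "x = 6"
    using assms(5) a E b that by (elim disjE) (simp_all, arith+)
qed

lemma admissible_expand:
  assumes "admissible x e a b n d"
  shows "0 \<le> n 0" "0 \<le> n 1" "0 \<le> n 2" "0 \<le> n 3" "0 \<le> n 4"
    and "0 \<le> d 0" "0 \<le> d 1" "0 \<le> d 2" "0 \<le> d 3" "0 \<le> d 4"
    and "n 0 + n 1 + n 2 + n 3 + n 4 = 5" "d 0 + d 1 + d 2 + d 3 + d 4 = 5"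
    and "n 1 + 2 * n 2 + 3 * n 3 + 4 * n 4 = x + 4 * e - a"
    and "d 1 + 2 * d 2 + 3 * d 3 + 4 * d 4 = x + 4 * e - b"
    and "5 * (n 1 + 4 * n 2 + 9 * n 3 + 16 * n 4 + d 1 + 4 * d 2 + 9 * d 3 + 16 * d 4) =
      2 * x\<^sup>2 + 4 * x + e * (8 * x + 100) - a * (2 * x + 8 * e - a) - b * (2 * x + 8 * e - b)"
  using assms by (simp_all add: admissible_def lessThan_5 all_less_5)

text \<open>The range condition is used in this form: a point value and a plane value whose sum is
  out of range exclude each other. Each instance is a case split for the linear arithmetic.\<close>

lemma admissible_disjoint:
  assumes "admissible x e a b n d" "j < 5" "k < 5"
    and "a + b + 5 * int (j + k) < x + 5 * e \<or> x + 25 < a + b + 5 * int (j + k)"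
  shows "n j = 0 \<or> d k = 0"
  using assms unfolding admissible_def by (metis leD le_less)

text \<open>The first moments are 5 and 5 and the squares add up to 14, so the sum of
  \<open>k * (k - 1)\<close> over all points and planes is 4. Without the index 2 it would be a
  multiple of 6.\<close>

lemma admissible_5_outside:
  assumes "admissible 5 0 0 0 n d"
  shows "0 < n 2 \<or> 0 < d 2"
proof -
  have "n 0 = 0 \<or> d 0 = 0" "n 3 = 0 \<or> d 4 = 0" "n 4 = 0 \<or> d 3 = 0" "n 4 = 0 \<or> d 4 = 0"
    by (rule admissible_disjoint[OF assms]; simp)+
  then show ?thesis
    using admissible_expand[OF assms, simplified] unfolding One_nat_def using [[smt_timeout = 120]] by (smt (z3))
qed

text \<open>The first moments are 9 and 9 and the squares add up to 42. An index 4 on one side would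
  force 1, 2, 2, 2, 2 on the other and 1, 1, 1, 2, 4 on its own side, with squares 17 + 23. An index
  0 would force all indices on the other side to be at least 2. What remains is 1, 1, 1, 3, 3 on
  both sides.\<close>

lemma admissible_5_inside:
  assumes "admissible 5 1 0 0 n d"
  shows "n 2 = 0 \<and> d 2 = 0"
proof -
  have "n 0 = 0 \<or> d 0 = 0" "n 0 = 0 \<or> d 1 = 0" "n 1 = 0 \<or> d 0 = 0" "n 3 = 0 \<or> d 4 = 0" "n 4 = 0 \<or> d 3 = 0" "n 4 = 0 \<or> d 4 = 0"
    by (rule admissible_disjoint[OF assms]; simp)+
  note excl = this admissible_expand[OF assms, simplified]
  have "n 4 = 0" using excl unfolding One_nat_def using [[smt_timeout = 120]] by (smt (z3))
  moreover have "d 4 = 0" using excl unfolding One_nat_def using [[smt_timeout = 120]] by (smt (z3))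
  ultimately show ?thesis using excl unfolding One_nat_def using [[smt_timeout = 120]] by (smt (z3))
qed

text \<open>The squares add up to 17, of which the points take at least 8 and the planes at least 5.
  This excludes a point of index 4 and a plane of index 3. A plane of index 2 then forces one of
  index 0, so no point has index 0 and the points have indices 1, 1, 1, 1, 2.\<close>

lemma admissible_6_outside:
  assumes "admissible 6 0 0 1 n d"
  shows "n 4 = 0 \<and> d 3 = 0 \<and> (0 < d 2 \<longrightarrow> 0 < n 1) \<and> (0 < n 1 \<or> 0 < n 2)"
proof -
  have "n 0 = 0 \<or> d 0 = 0" "n 3 = 0 \<or> d 4 = 0" "n 4 = 0 \<or> d 3 = 0" "n 4 = 0 \<or> d 4 = 0"
    by (rule admissible_disjoint[OF assms]; simp)+
  then show ?thesis
    using admissible_expand[OF assms, simplified] unfolding One_nat_def using [[smt_timeout = 120]] by (smt (z3))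
qed

text \<open>If no point has index 4 and no plane index 3, the only solution is 2, 2, 2, 2, 2 for the
  points and 0, 1, 2, 2, 4 for the planes.\<close>

lemma admissible_6_inside:
  assumes "admissible 6 1 0 1 n d"
  shows "0 < n 4 \<or> 0 < d 3 \<or> n 1 = 0 \<and> 0 < d 2"
proof -
  have "n 0 = 0 \<or> d 0 = 0" "n 0 = 0 \<or> d 1 = 0" "n 1 = 0 \<or> d 0 = 0" "n 3 = 0 \<or> d 4 = 0" "n 4 = 0 \<or> d 3 = 0" "n 4 = 0 \<or> d 4 = 0"
    by (rule admissible_disjoint[OF assms]; simp)+
  note facts = this admissible_expand[OF assms, simplified]
  have "n 1 = 0" if "n 4 = 0" "d 3 = 0" using facts that unfolding One_nat_def using [[smt_timeout = 120]] by (smt (z3))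
  moreover have "0 < d 2" if "n 4 = 0" "d 3 = 0" "n 1 = 0"
    using facts that unfolding One_nat_def using [[smt_timeout = 120]] by (smt (z3))
  ultimately show ?thesis
    using admissible_expand(5,9)[OF assms] by fastforce
qed


section \<open>Moments of a function with constant residue modulo 5\<close>

lemma sum_by_quotient:
  fixes f :: "'a \<Rightarrow> int" and g :: "nat \<Rightarrow> int"
  assumes "finite A" "\<forall>a\<in>A. 0 \<le> f a \<and> f a < 25"
  shows "(\<Sum>k<5. g k * int (card {a \<in> A. f a div 5 = int k})) = (\<Sum>a\<in>A. g (nat (f a div 5)))"
proof -
  have "(\<Sum>a\<in>A. g (nat (f a div 5))) =
      (\<Sum>k<5. \<Sum>a\<in>{a \<in> A. nat (f a div 5) = k}. g (nat (f a div 5)))"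
    by (rule sum.group[symmetric]) (use assms in \<open>fastforce+\<close>)
  also have "\<dots> = (\<Sum>k<5. g k * int (card {a \<in> A. f a div 5 = int k}))"
  proof (rule sum.cong)
    fix k :: nat
    have "{a \<in> A. nat (f a div 5) = k} = {a \<in> A. f a div 5 = int k}"
      using assms(2) by (auto simp: nat_eq_iff pos_imp_zdiv_nonneg_iff)
    moreover have "(\<Sum>a\<in>{a \<in> A. nat (f a div 5) = k}. g (nat (f a div 5))) =
        (\<Sum>a\<in>{a \<in> A. nat (f a div 5) = k}. g k)"
      by (rule sum.cong) auto
    ultimately show "(\<Sum>a\<in>{a \<in> A. nat (f a div 5) = k}. g (nat (f a div 5))) =
        g k * int (card {a \<in> A. f a div 5 = int k})"
      by simp
  qed simp
  finally show ?thesis by simp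
qed

text \<open>Writing \<open>f a = r + 5 * k\<close> and grouping by the quotient \<open>k\<close>
  expresses the sums of \<open>f\<close> and its square by moments of the distribution of
  \<open>k\<close>.\<close>

lemma moments_by_quotient:
  fixes f :: "'a \<Rightarrow> int"
  assumes "finite A" "\<forall>a\<in>A. 0 \<le> f a \<and> f a < 25" "\<forall>a\<in>A. f a mod 5 = r"
  defines "n \<equiv> \<lambda>k. int (card {a \<in> A. f a div 5 = int k})"
  shows "(\<Sum>k<5. n k) = int (card A)"
    and "(\<Sum>a\<in>A. f a) = int (card A) * r + 5 * (\<Sum>k<5. int k * n k)"
    and "(\<Sum>a\<in>A. (f a)\<^sup>2) = int (card A) * r\<^sup>2 + 10 * r * (\<Sum>k<5. int k * n k)
      + 25 * (\<Sum>k<5. (int k)\<^sup>2 * n k)"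
proof -
  note quot = sum_by_quotient[where f = f, OF assms(1,2)]
  have f: "f a = r + 5 * int (nat (f a div 5))" if "a \<in> A" for a
    using assms(2,3) that mult_div_mod_eq[of 5 "f a"] by (simp add: pos_imp_zdiv_nonneg_iff)
  show "(\<Sum>k<5. n k) = int (card A)"
    using quot[where g = "\<lambda>_. 1"] by (simp add: n_def)
  have "(\<Sum>a\<in>A. f a) = (\<Sum>a\<in>A. r + 5 * int (nat (f a div 5)))"
    by (rule sum.cong[OF refl]) (rule f)
  then show "(\<Sum>a\<in>A. f a) = int (card A) * r + 5 * (\<Sum>k<5. int k * n k)"
    unfolding n_def quot[where g = "\<lambda>k. int k"] by (simp only: sum.distrib sum_distrib_left[symmetric] sum_constant)
  have "(\<Sum>a\<in>A. (f a)\<^sup>2) = (\<Sum>a\<in>A. r\<^sup>2 + 10 * r * int (nat (f a div 5)) + 25 * (int (nat (f a div 5)))\<^sup>2)"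
  proof (rule sum.cong[OF refl])
    fix a assume "a \<in> A"
    then show "(f a)\<^sup>2 = r\<^sup>2 + 10 * r * int (nat (f a div 5)) + 25 * (int (nat (f a div 5)))\<^sup>2"
      by (subst f) (simp_all only: power2_eq_square, algebra)
  qed
  then show "(\<Sum>a\<in>A. (f a)\<^sup>2) = int (card A) * r\<^sup>2 + 10 * r * (\<Sum>k<5. int k * n k)
      + 25 * (\<Sum>k<5. (int k)\<^sup>2 * n k)"
    unfolding n_def quot[where g = "\<lambda>k. int k"] quot[where g = "\<lambda>k. (int k)\<^sup>2"]
    by (simp only: sum.distrib sum_distrib_left[symmetric] sum_constant)
qed

section \<open>Value distributions on a line for \<open>q = 4\<close>\<close>

locale cameron_liebler_class_4 = cameron_liebler_class +
  assumes q_eq: "q = 4"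
begin

lemma dual_class_4:
  "cameron_liebler_class_4 Pl Ln Pt (\<lambda>h l. lies l h) (\<lambda>l P. on P l) q L x"
  by (intro cameron_liebler_class_4.intro dual_class cameron_liebler_class_4_axioms.intro q_eq)

lemma chi_cases: "chi l = 0 \<or> chi l = 1"
  by (simp add: chi_def)

lemma s_bounds:
  assumes "P \<in> Pt"
  shows "0 \<le> s P" "s P \<le> 21"
proof -
  have "card {l \<in> L. on P l} \<le> card {l \<in> Ln. on P l}"
    by (rule card_mono) (use finite_Ln L_subset in auto)
  then show "0 \<le> s P" "s P \<le> 21"
    using card_star[OF assms] q_eq by (simp_all add: s_def)
qed

lemma line_on_point_outside:
  assumes "P \<in> Pt" "s P < 21"
  obtains l where "l \<in> Ln" "on P l" "l \<notin> L"
proof -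
  have "{l \<in> L. on P l} \<noteq> {l \<in> Ln. on P l}"
    using card_star[OF assms(1)] q_eq assms(2) by (auto simp: s_def)
  then show ?thesis using L_subset that by blast
qed

lemma line_on_point_inside:
  assumes "0 < s P"
  obtains l where "l \<in> L" "on P l"
proof -
  have "{l \<in> L. on P l} \<noteq> {}" using assms unfolding s_def by (metis card.empty less_irrefl of_nat_0)
  then show ?thesis using that by blast
qed

lemma p_bounds:
  assumes "h \<in> Pl"
  shows "0 \<le> p h" "p h \<le> 21"
proof -
  interpret dual: cameron_liebler_class_4 Pl Ln Pt "\<lambda>h l. lies l h" "\<lambda>l P. on P l" q L x
    by (rule dual_class_4)
  show "0 \<le> p h" "p h \<le> 21" using dual.s_bounds[OF assms] by (simp_all add: dual.s_def p_def)
qed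

lemma line_in_plane_outside:
  assumes "h \<in> Pl" "p h < 21"
  obtains l where "l \<in> Ln" "lies l h" "l \<notin> L"
proof -
  interpret dual: cameron_liebler_class_4 Pl Ln Pt "\<lambda>h l. lies l h" "\<lambda>l P. on P l" q L x
    by (rule dual_class_4)
  show ?thesis using dual.line_on_point_outside[OF assms(1)] assms(2) that
    by (auto simp: dual.s_def p_def)
qed

lemma line_in_plane_inside:
  assumes "0 < p h"
  obtains l where "l \<in> L" "lies l h"
proof -
  have "{l \<in> L. lies l h} \<noteq> {}" using assms unfolding p_def by (metis card.empty less_irrefl of_nat_0)
  then show ?thesis using that by blast
qed

lemma c_bounds:
  assumes "P \<in> Pt" "h \<in> Pl" "l \<in> Ln" "on P l" "lies l h"
  shows "chi l \<le> c P h" "c P h \<le> 5"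
proof -
  have "card {k \<in> L. on P k \<and> lies k h} \<le> card {k \<in> Ln. on P k \<and> lies k h}"
    by (rule card_mono) (use finite_Ln L_subset in auto)
  then show "c P h \<le> 5" using card_pencil[OF assms] q_eq by (simp add: c_def)
  show "chi l \<le> c P h"
  proof (cases "l \<in> L")
    case True
    then have "0 < card {k \<in> L. on P k \<and> lies k h}"
      using finite_L assms by (subst card_gt_0_iff) auto
    then show ?thesis using True by (simp add: chi_def c_def)
  qed (simp add: chi_def c_def)
qed

text \<open>Values are at most 21, so the indices \<open>k < 5\<close> cover all points. Together
  with the common residue on \<open>l\<close>, the quotient determines the value.\<close>

definition pts where "pts l k = int (card {P \<in> {P \<in> Pt. on P l}. s P div 5 = int k})"
definition pls where "pls l k = int (card {h \<in> {h \<in> Pl. lies l h}. p h div 5 = int k})"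

lemma pts_posD:
  assumes "0 < pts l k"
  obtains P where "P \<in> Pt" "on P l" "s P div 5 = int k"
proof -
  have "{P \<in> {P \<in> Pt. on P l}. s P div 5 = int k} \<noteq> {}"
    using assms unfolding pts_def by (metis card.empty less_irrefl of_nat_0)
  then show ?thesis using that by blast
qed

lemma pls_posD:
  assumes "0 < pls l k"
  obtains h where "h \<in> Pl" "lies l h" "p h div 5 = int k"
proof -
  have "{h \<in> {h \<in> Pl. lies l h}. p h div 5 = int k} \<noteq> {}"
    using assms unfolding pls_def by (metis card.empty less_irrefl of_nat_0)
  then show ?thesis using that by blast
qed

lemma pts_posI: "P \<in> Pt \<Longrightarrow> on P l \<Longrightarrow> s P div 5 = int k \<Longrightarrow> 0 < pts l k"
  unfolding pts_def of_nat_0_less_iff using finite_Pt by (subst card_gt_0_iff) auto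

lemma pls_posI: "h \<in> Pl \<Longrightarrow> lies l h \<Longrightarrow> p h div 5 = int k \<Longrightarrow> 0 < pls l k"
  unfolding pls_def of_nat_0_less_iff using finite_Pl by (subst card_gt_0_iff) auto

definition profile where
  "profile l a b \<longleftrightarrow> l \<in> Ln \<and> (\<forall>P\<in>Pt. on P l \<longrightarrow> s P mod 5 = a) \<and> (\<forall>h\<in>Pl. lies l h \<longrightarrow> p h mod 5 = b)
    \<and> admissible x (chi l) a b (pts l) (pls l)"

text \<open>By \<open>flag\<close>, \<open>s P + p h\<close> is congruent to \<open>x\<close> modulo
  5 for every point \<open>P\<close> on \<open>l\<close> and plane \<open>h\<close> through
  \<open>l\<close>, so the residues are constant along \<open>l\<close>. The moment equations are
  \<open>sum_s\<close>, \<open>sum_p\<close> and \<open>sum_squares\<close> rewritten for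
  quotients.\<close>

lemma profile_exists:
  assumes l: "l \<in> Ln"
  shows "\<exists>a b. a \<in> {0..<5} \<and> b \<in> {0..<5} \<and> (a + b) mod 5 = x mod 5 \<and> profile l a b"
proof -
  let ?A = "{P \<in> Pt. on P l}" and ?B = "{h \<in> Pl. lies l h}"
  have A: "card ?A = 5" and B: "card ?B = 5"
    using card_points_on[OF l] card_planes_through[OF l] q_eq by auto
  then have "?A \<noteq> {}" "?B \<noteq> {}" by (metis card.empty zero_neq_numeral)+
  then obtain P0 h0 where P0: "P0 \<in> Pt" "on P0 l" and h0: "h0 \<in> Pl" "lies l h0" by blast
  define a where "a = s P0 mod 5"
  define b where "b = p h0 mod 5"
  have flag: "s P + p h = x + 5 * c P h" if "P \<in> Pt" "on P l" "h \<in> Pl" "lies l h" for P h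
    using flag[OF that(1,3) l that(2,4)] q_eq by simp
  have sa: "s P mod 5 = a" if "P \<in> Pt" "on P l" for P
  proof -
    have "s P = s P0 + 5 * (c P h0 - c P0 h0)" using flag[OF that h0] flag[OF P0 h0] by simp
    then show ?thesis unfolding a_def by (simp only: mod_mult_self2)
  qed
  have pb: "p h mod 5 = b" if "h \<in> Pl" "lies l h" for h
  proof -
    have "p h = p h0 + 5 * (c P0 h - c P0 h0)" using flag[OF P0 that] flag[OF P0 h0] by simp
    then show ?thesis unfolding b_def by (simp only: mod_mult_self2)
  qed
  have ab: "(a + b) mod 5 = x mod 5"
    using flag[OF P0 h0] unfolding a_def b_def by (simp only: mod_add_eq mod_mult_self2)
  have rng: "a \<in> {0..<5}" "b \<in> {0..<5}" unfolding a_def b_def by auto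
  have finA: "finite ?A" "finite ?B" using finite_Pt finite_Pl by auto
  have sA: "\<forall>P\<in>?A. 0 \<le> s P \<and> s P < 25" and sa': "\<forall>P\<in>?A. s P mod 5 = a"
    using s_bounds sa by fastforce+
  have pB: "\<forall>h\<in>?B. 0 \<le> p h \<and> p h < 25" and pb': "\<forall>h\<in>?B. p h mod 5 = b"
    using p_bounds pb by fastforce+
  note mA = moments_by_quotient[where f = s, OF finA(1) sA sa', folded pts_def, unfolded A]
  note mB = moments_by_quotient[where f = p, OF finA(2) pB pb', folded pls_def, unfolded B]
  let ?K = "\<Sum>k<5. int k * pts l k" and ?K' = "\<Sum>k<5. int k * pls l k"
  let ?E = "(\<Sum>k<5. (int k)\<^sup>2 * pts l k) + (\<Sum>k<5. (int k)\<^sup>2 * pls l k)"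
  have K: "?K = x + 4 * chi l - a" and K': "?K' = x + 4 * chi l - b"
    using mA(2) mB(2) sum_s[OF l] sum_p[OF l] q_eq by simp_all
  \<comment> \<open>Here \<open>a\<^sup>2 + 2 * a * ?K\<close> becomes
    \<open>a * (2 * x + 8 * chi l - a)\<close>, and likewise for \<open>b\<close>.\<close>
  have "5 * (5 * ?E) = 5 * (2 * x\<^sup>2 + 4 * x + chi l * (8 * x + 100) - a * (2 * x + 8 * chi l - a) - b * (2 * x + 8 * chi l - b))"
    using mA(3) mB(3) sum_squares[OF l] q_eq unfolding K K'
    by (simp add: algebra_simps power2_eq_square)
  then have E: "5 * ?E = 2 * x\<^sup>2 + 4 * x + chi l * (8 * x + 100) - a * (2 * x + 8 * chi l - a) - b * (2 * x + 8 * chi l - b)"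
    by simp
  \<comment> \<open>By \<open>flag\<close> the sum of the two values is
    \<open>x + 5 * c P h\<close>, and \<open>c P h\<close> lies between \<open>chi l\<close> and
    5.\<close>
  have bounds: "x + 5 * chi l \<le> a + b + 5 * int (j + k) \<and> a + b + 5 * int (j + k) \<le> x + 25"
    if jk: "0 < pts l j" "0 < pls l k" for j k
  proof -
    obtain P where P: "P \<in> Pt" "on P l" "s P div 5 = int j" using jk(1) by (rule pts_posD)
    obtain h where h: "h \<in> Pl" "lies l h" "p h div 5 = int k" using jk(2) by (rule pls_posD)
    have "s P = a + 5 * int j" "p h = b + 5 * int k"
      using sa[OF P(1,2)] P(3) pb[OF h(1,2)] h(3) by presburger+
    then show ?thesis
      using flag[OF P(1,2) h(1,2)] c_bounds[OF P(1) h(1) l P(2) h(2)] by simp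
  qed
  have "admissible x (chi l) a b (pts l) (pls l)"
    unfolding admissible_def using mA(1) mB(1) K K' E bounds
    by (simp add: pts_def pls_def)
  then show ?thesis using rng ab sa pb l unfolding profile_def by blast
qed

section \<open>Exclusion of the parameters 4, 8, 5 and 6\<close>

lemma line_outside_exists:
  assumes "x < 17"
  obtains l where "l \<in> Ln" "l \<notin> L"
proof -
  \<comment> \<open>There are \<open>17 * 21\<close> lines in all and \<open>21 * x\<close> in the
    class.\<close>
  have "L \<noteq> Ln" using card_L card_Ln q_eq assms by auto
  then show ?thesis using L_subset that by blast
qed

lemma not_4_8: "x \<noteq> 4 \<and> x \<noteq> 8"
proof (rule ccontr)
  assume neg: "\<not> (x \<noteq> 4 \<and> x \<noteq> 8)"
  then have "x < 17" by auto
  then obtain l where l: "l \<in> Ln" "l \<notin> L" by (rule line_outside_exists)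
  obtain a b where ab: "a \<in> {0..<5}" "b \<in> {0..<5}" "(a + b) mod 5 = x mod 5"
    "admissible x (chi l) a b (pts l) (pls l)"
    using profile_exists[OF l(1)] unfolding profile_def by auto
  have "chi l = 1"
    using admissible_residues(1,2)[OF ab(4,1-3) chi_cases] neg by blast
  then show False using l by (simp add: chi_def)
qed

lemma profile_5:
  assumes "x = 5" "l \<in> Ln"
  shows "profile l 0 0"
proof -
  obtain a b where ab: "a \<in> {0..<5}" "b \<in> {0..<5}" "(a + b) mod 5 = x mod 5" "profile l a b"
    using profile_exists[OF assms(2)] by auto
  then have "a = 0 \<and> b = 0"
    using admissible_residues(3)[OF _ ab(1-3) chi_cases] assms(1) unfolding profile_def by auto
  then show ?thesis using ab(4) by simp
qed

text \<open>A point or plane of value 10 on a line outside the class has positive value, so it is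
  also incident with a line of the class, where this value is impossible.\<close>

lemma not_5: "x \<noteq> 5"
proof
  assume x: "x = 5"
  have inside: "pts l 2 = 0 \<and> pls l 2 = 0" if "l \<in> L" for l
    using profile_5[OF x, of l] admissible_5_inside x that L_subset unfolding profile_def by (auto simp: chi_def)
  obtain l where l: "l \<in> Ln" "l \<notin> L" using x line_outside_exists by force
  then have "0 < pts l 2 \<or> 0 < pls l 2"
    using profile_5[OF x, of l] admissible_5_outside x unfolding profile_def by (auto simp: chi_def)
  then show False
  proof
    assume "0 < pts l 2"
    then obtain P where P: "P \<in> Pt" "on P l" "s P div 5 = int 2" by (rule pts_posD)
    then have "0 < s P" by presburger
    then obtain m where "m \<in> L" "on P m" by (rule line_on_point_inside)
    then show False using inside[of m] pts_posI[of P m 2] P by simp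
  next
    assume "0 < pls l 2"
    then obtain h where h: "h \<in> Pl" "lies l h" "p h div 5 = int 2" by (rule pls_posD)
    then have "0 < p h" by presburger
    then obtain m where "m \<in> L" "lies m h" by (rule line_in_plane_inside)
    then show False using inside[of m] pls_posI[of h m 2] h by simp
  qed
qed

lemma profile_6:
  assumes "x = 6" "l \<in> Ln"
  shows "profile l 0 1 \<or> profile l 1 0"
proof -
  obtain a b where ab: "a \<in> {0..<5}" "b \<in> {0..<5}" "(a + b) mod 5 = x mod 5" "profile l a b"
    using profile_exists[OF assms(2)] by auto
  then have "a = 0 \<and> b = 1 \<or> a = 1 \<and> b = 0"
    using admissible_residues(4)[OF _ ab(1-3) chi_cases] assms(1) unfolding profile_def by auto
  then show ?thesis using ab(4) by auto
qed

text \<open>The two possible profiles of \<open>m\<close> differ in the residue of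
  \<open>s P\<close>, which is already fixed by \<open>l\<close>. Thus the profile spreads along
  intersections.\<close>

lemma profile_6_point:
  assumes "x = 6" "profile l 0 1" "P \<in> Pt" "on P l" "m \<in> Ln" "on P m"
  shows "profile m 0 1"
  using profile_6[OF assms(1,5)] assms(2-6) unfolding profile_def by force

lemma profile_6_plane:
  assumes "x = 6" "profile l 0 1" "h \<in> Pl" "lies l h" "m \<in> Ln" "lies m h"
  shows "profile m 0 1"
  using profile_6[OF assms(1,5)] assms(2-6) unfolding profile_def by force

lemma profile_6_outside:
  assumes "x = 6" "profile l 0 1" "l \<notin> L"
  shows "pts l 4 = 0" "pls l 3 = 0" "0 < pls l 2 \<Longrightarrow> 0 < pts l 1" "0 < pts l 1 \<or> 0 < pts l 2"
  using admissible_6_outside[of "pts l" "pls l"] assms unfolding profile_def by (auto simp: chi_def)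

text \<open>A point of value 20 or a plane of value 16 is incident with a line outside the class, as
  its value is below 21. That line has the same profile, which does not allow such a value. This
  leaves one alternative of \<open>admissible_6_inside\<close>.\<close>

lemma profile_6_inside:
  assumes x: "x = 6" and k: "profile l 0 1" and l: "l \<in> L"
  shows "pts l 1 = 0" "0 < pls l 2"
proof -
  have "\<not> 0 < pts l 4"
  proof
    assume "0 < pts l 4"
    then obtain P where P: "P \<in> Pt" "on P l" "s P div 5 = int 4" by (rule pts_posD)
    then have "s P mod 5 = 0" using k by (auto simp: profile_def)
    then have "s P < 21" using P(3) mult_div_mod_eq[of 5 "s P"] by simp
    then obtain m where m: "m \<in> Ln" "on P m" "m \<notin> L" using line_on_point_outside[OF P(1)] by blast
    have "profile m 0 1" using profile_6_point[OF x k P(1,2) m(1,2)] .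
    then show False using profile_6_outside(1)[OF x _ m(3)] pts_posI[OF P(1) m(2) P(3)] by simp
  qed
  moreover have "\<not> 0 < pls l 3"
  proof
    assume "0 < pls l 3"
    then obtain h where h: "h \<in> Pl" "lies l h" "p h div 5 = int 3" by (rule pls_posD)
    then have "p h < 21" by presburger
    then obtain m where m: "m \<in> Ln" "lies m h" "m \<notin> L" using line_in_plane_outside[OF h(1)] by blast
    have "profile m 0 1" using profile_6_plane[OF x k h(1,2) m(1,2)] .
    then show False using profile_6_outside(2)[OF x _ m(3)] pls_posI[OF h(1) m(2) h(3)] by simp
  qed
  ultimately show "pts l 1 = 0" "0 < pls l 2"
    using admissible_6_inside[of "pts l" "pls l"] x k l unfolding profile_def by (auto simp: chi_def)
qed

lemma no_profile_6:
  assumes x: "x = 6"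
  shows "\<not> profile l 0 1"
proof
  assume k: "profile l 0 1"
  \<comment> \<open>A line outside the class has a point of value 5 or 10, through which a line of
    the class passes.\<close>
  have "\<exists>m\<in>L. profile m 0 1"
  proof (cases "l \<in> L")
    case False
    obtain P j where P: "P \<in> Pt" "on P l" "s P div 5 = int j" "0 < j"
      using profile_6_outside(4)[OF x k False] by (metis pts_posD zero_less_numeral zero_less_one)
    then have "0 < s P" by presburger
    then obtain m where m: "m \<in> L" "on P m" by (rule line_on_point_inside)
    then have "profile m 0 1" using profile_6_point[OF x k P(1,2)] L_subset by blast
    then show ?thesis using m by blast
  qed (use k in blast)
  then obtain m where m: "m \<in> L" "profile m 0 1" by blast
  obtain h where h: "h \<in> Pl" "lies m h" "p h div 5 = int 2"
    using profile_6_inside(2)[OF x m(2,1)] by (rule pls_posD)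
  then have "p h < 21" by presburger
  \<comment> \<open>The plane \<open>h\<close> has value 11. On a line of it outside the class this
    forces a point of value 5, and a line of the class through that point yields the
    contradiction.\<close>
  then obtain k where k: "k \<in> Ln" "lies k h" "k \<notin> L" using line_in_plane_outside[OF h(1)] by blast
  have k0: "profile k 0 1" using profile_6_plane[OF x m(2) h(1,2) k(1,2)] .
  have "0 < pts k 1" using profile_6_outside(3)[OF x k0 k(3)] pls_posI[OF h(1) k(2) h(3)] by simp
  then obtain P where P: "P \<in> Pt" "on P k" "s P div 5 = int 1" by (rule pts_posD)
  then have "0 < s P" by presburger
  then obtain t where t: "t \<in> L" "on P t" by (rule line_on_point_inside)
  then have "profile t 0 1" using profile_6_point[OF x k0 P(1,2)] L_subset by blast
  then show False using profile_6_inside(1)[OF x _ t(1)] pts_posI[OF P(1) t(2) P(3)] by simp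
qed

text \<open>The profile with residues 0 and 1 is impossible in the space and in its dual. The first
  leaves residue 1 for every \<open>s P\<close>, the second leaves residue 0.\<close>

lemma not_6: "x \<noteq> 6"
proof
  assume x: "x = 6"
  interpret dual: cameron_liebler_class_4 Pl Ln Pt "\<lambda>h l. lies l h" "\<lambda>l P. on P l" q L x
    by (rule dual_class_4)
  obtain l where l: "l \<in> Ln" "l \<notin> L" using x line_outside_exists by force
  have "{P \<in> Pt. on P l} \<noteq> {}" using card_points_on[OF l(1)] by (metis card.empty add_is_0 zero_neq_one)
  then obtain P where P: "P \<in> Pt" "on P l" by blast
  have "s P mod 5 = 1"
    using profile_6[OF x l(1)] no_profile_6[OF x] P by (auto simp: profile_def)
  moreover have "dual.p P mod 5 = 0"
    using dual.profile_6[OF x l(1)] dual.no_profile_6[OF x] P by (auto simp: dual.profile_def)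
  ultimately show False by (simp add: s_def dual.p_def)
qed

end

section \<open>Subspaces of a 4-dimensional space over a finite field\<close>

lemma card_span_independent:
  fixes B :: "('a::{field,finite} ^ 'n) set"
  assumes "finite B" "vec.independent B"
  shows "card (vec.span B) = CARD('a) ^ card B"
  using assms
proof (induction B rule: finite_induct)
  case (insert v B)
  have v: "v \<notin> vec.span B" and B: "vec.independent B"
    using insert.prems insert.hyps(2) by (simp_all add: vec.independent_insert)
  have "bij_betw (\<lambda>(c, w). w + c *s v) (UNIV \<times> vec.span B) (vec.span (insert v B))"
  proof (rule bij_betw_imageI)
    show "inj_on (\<lambda>(c, w). w + c *s v) (UNIV \<times> vec.span B)"
    proof (intro inj_onI, clarify)
      fix c w c' w' assume w: "w \<in> vec.span B" "w' \<in> vec.span B" and eq: "w + c *s v = w' + c' *s v"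
      have "(c - c') *s v = w' - w" using eq by (simp add: vec.scale_left_diff_distrib algebra_simps)
      then have "(c - c') *s v \<in> vec.span B" using w vec.span_diff by metis
      then have "inverse (c - c') *s ((c - c') *s v) \<in> vec.span B" by (rule vec.span_scale)
      then have "c = c'" using v by (cases "c = c'") simp_all
      then show "c = c' \<and> w = w'" using eq by simp
    qed
    show "(\<lambda>(c, w). w + c *s v) ` (UNIV \<times> vec.span B) = vec.span (insert v B)"
    proof (intro equalityI subsetI)
      fix u assume "u \<in> vec.span (insert v B)"
      then obtain c where "u - c *s v \<in> vec.span B" by (auto simp: vec.span_breakdown_eq)
      then show "u \<in> (\<lambda>(c, w). w + c *s v) ` (UNIV \<times> vec.span B)"
        by (intro image_eqI[of _ _ "(c, u - c *s v)"]) auto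
    next
      fix u assume "u \<in> (\<lambda>(c, w). w + c *s v) ` (UNIV \<times> vec.span B)"
      then obtain c w where "w \<in> vec.span B" "u = w + c *s v" by auto
      then have "u - c *s v \<in> vec.span B" by simp
      then show "u \<in> vec.span (insert v B)" unfolding vec.span_breakdown_eq by blast
    qed
  qed
  then have "card (vec.span (insert v B)) = card (UNIV \<times> vec.span B :: ('a \<times> _) set)"
    by (rule bij_betw_same_card[symmetric])
  then show ?case using insert.IH[OF B] insert.hyps by (simp add: card_cartesian_product)
qed (simp add: card_1_singleton_iff)

lemma card_subspace:
  fixes S :: "('a::{field,finite} ^ 'n) set"
  assumes "vec.subspace S"
  shows "card S = CARD('a) ^ vec.dim S"
proof -
  obtain B where B: "B \<subseteq> S" "vec.independent B" "S \<subseteq> vec.span B" "card B = vec.dim S"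
    using vec.basis_exists by blast
  then have "vec.span B = S" using assms vec.span_minimal by blast
  then show ?thesis using card_span_independent[OF vec.finiteI_independent[OF B(2)] B(2)] B(4) by simp
qed

lemma CARD_field_gt_1: "1 < CARD('a::{field,finite})"
proof -
  have "card {0, 1::'a} \<le> CARD('a)" by (rule card_mono) auto
  then show ?thesis by simp
qed

text \<open>The sets \<open>U - W\<close> partition \<open>V - W\<close>: a vector \<open>v\<close>
  outside \<open>W\<close> lies in exactly one \<open>U\<close>, the span of \<open>W\<close> and
  \<open>v\<close>. All parts have the same size.\<close>

lemma card_intermediate_mult:
  fixes W V :: "('a::{field,finite} ^ 'n) set"
  assumes W: "vec.subspace W" and V: "vec.subspace V" and WV: "W \<subseteq> V"
  shows "card {U. vec.subspace U \<and> vec.dim U = vec.dim W + 1 \<and> W \<subseteq> U \<and> U \<subseteq> V} *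
      (CARD('a) ^ (vec.dim W + 1) - CARD('a) ^ vec.dim W) = CARD('a) ^ vec.dim V - CARD('a) ^ vec.dim W"
proof -
  let ?U = "{U. vec.subspace U \<and> vec.dim U = vec.dim W + 1 \<and> W \<subseteq> U \<and> U \<subseteq> V}"
  have spanW: "vec.span W = W" using W by simp
  have ins: "vec.span (insert v W) \<in> ?U" if "v \<in> V - W" for v
  proof -
    have "vec.dim (insert v W) = vec.dim W + 1" using that by (simp add: vec.dim_insert spanW del: vec.span_eq_iff)
    then show ?thesis
      using that V WV vec.span_minimal[of "insert v W" V] vec.span_superset[of "insert v W"] by auto
  qed
  have uniq: "U = vec.span (insert v W)" if "U \<in> ?U" "v \<in> U - W" for U v
  proof (rule vec.subspace_dim_equal[symmetric])
    show "vec.span (insert v W) \<subseteq> U" using that by (intro vec.span_minimal) auto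
    show "vec.dim U \<le> vec.dim (vec.span (insert v W))" using that by (simp add: vec.dim_insert spanW del: vec.span_eq_iff)
  qed (use that in auto)
  have "V - W = (\<Union>U\<in>?U. U - W)"
  proof (intro equalityI subsetI)
    fix v assume v: "v \<in> V - W"
    moreover have "v \<in> vec.span (insert v W)" by (rule vec.span_base) simp
    ultimately show "v \<in> (\<Union>U\<in>?U. U - W)" using ins[OF v] by blast
  qed auto
  moreover have "(U - W) \<inter> (U' - W) = {}" if "U \<in> ?U" "U' \<in> ?U" "U \<noteq> U'" for U U'
    using uniq[OF that(1)] uniq[OF that(2)] that(3) by blast
  ultimately have "card (V - W) = (\<Sum>U\<in>?U. card (U - W))"
    by (simp only:) (rule card_UN_disjoint; simp)
  also have "\<dots> = (\<Sum>U\<in>?U. CARD('a) ^ (vec.dim W + 1) - CARD('a) ^ vec.dim W)"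
    by (rule sum.cong) (auto simp: card_Diff_subset card_subspace W)
  finally show ?thesis
    using WV by (simp add: card_Diff_subset card_subspace W V)
qed

text \<open>After cancelling \<open>q^k * (q - 1)\<close>, where \<open>k\<close> is the dimension
  of \<open>W\<close>, the quotient is a geometric series. The computation is done in the integers
  to avoid truncated subtraction.\<close>

lemma card_intermediate:
  fixes W V :: "('a::{field,finite} ^ 'n) set"
  assumes "vec.subspace W" "vec.subspace V" "W \<subseteq> V" and m: "vec.dim V = vec.dim W + m"
  shows "card {U. vec.subspace U \<and> vec.dim U = vec.dim W + 1 \<and> W \<subseteq> U \<and> U \<subseteq> V} = (\<Sum>i<m. CARD('a) ^ i)"
    (is "?N = _")
proof -
  let ?q = "int CARD('a)" and ?k = "vec.dim W"
  have "int (?N * (CARD('a) ^ (?k + 1) - CARD('a) ^ ?k)) = int (CARD('a) ^ (?k + m) - CARD('a) ^ ?k)"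
    using card_intermediate_mult[OF assms(1-3)] by (simp only: m)
  then have "int ?N * (?q ^ (?k + 1) - ?q ^ ?k) = ?q ^ (?k + m) - ?q ^ ?k"
    using CARD_field_gt_1[where 'a = 'a] by (simp add: of_nat_diff power_increasing)
  then have "?q ^ ?k * ((?q - 1) * int ?N) = ?q ^ ?k * ((?q - 1) * (\<Sum>i<m. ?q ^ i))"
    unfolding power_diff_1_eq[symmetric] by (simp only: power_add power_one_right) (simp add: algebra_simps)
  then have "int ?N = int (\<Sum>i<m. CARD('a) ^ i)"
    using CARD_field_gt_1[where 'a = 'a] by simp
  then show ?thesis by (simp only: of_nat_eq_iff)
qed

section \<open>Joins, dimensions and incidence of points, lines and planes\<close>

definition join :: "('a::field ^ 'n) set \<Rightarrow> ('a ^ 'n) set \<Rightarrow> ('a ^ 'n) set" where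
  "join S T = {x + y | x y. x \<in> S \<and> y \<in> T}"

lemma
  assumes "vec.subspace S" "vec.subspace T"
  shows subspace_join: "vec.subspace (join S T)"
    and join_upper1: "S \<subseteq> join S T" and join_upper2: "T \<subseteq> join S T"
    and dim_join: "vec.dim (join S T) + vec.dim (S \<inter> T) = vec.dim S + vec.dim T"
proof -
  show "vec.subspace (join S T)" unfolding join_def by (rule vec.subspace_sums[OF assms])
  show "vec.dim (join S T) + vec.dim (S \<inter> T) = vec.dim S + vec.dim T"
    unfolding join_def by (rule vec.dim_sums_Int[OF assms])
  have "x = x + 0" "x = 0 + x" for x :: "'a ^ 'n" by simp_all
  then show "S \<subseteq> join S T" "T \<subseteq> join S T"
    using vec.subspace_0[OF assms(1)] vec.subspace_0[OF assms(2)] unfolding join_def by blast+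
qed

lemma join_least:
  "\<lbrakk>vec.subspace U; S \<subseteq> U; T \<subseteq> U\<rbrakk> \<Longrightarrow> join S T \<subseteq> U"
  unfolding join_def using vec.subspace_add by blast

lemma subspace_eqI:
  "\<lbrakk>vec.subspace S; vec.subspace T; S \<subseteq> T; vec.dim T \<le> vec.dim S\<rbrakk> \<Longrightarrow> S = T"
  by (rule vec.subspace_dim_equal)

definition pg_planes :: "('a::{field,finite} ^ 4) set set" where
  "pg_planes = {h. vec.subspace h \<and> vec.dim h = 3}"

lemma pg_pointsD: "P \<in> pg_points \<Longrightarrow> vec.subspace P" "P \<in> pg_points \<Longrightarrow> vec.dim P = 1"
  and pg_linesD: "l \<in> pg_lines \<Longrightarrow> vec.subspace l" "l \<in> pg_lines \<Longrightarrow> vec.dim l = 2"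
  and pg_planesD: "h \<in> pg_planes \<Longrightarrow> vec.subspace h" "h \<in> pg_planes \<Longrightarrow> vec.dim h = 3"
  by (simp_all add: pg_points_def pg_lines_def pg_planes_def)

lemma dim_UNIV_4: "vec.dim (UNIV :: ('a::field ^ 4) set) = 4"
  unfolding vec_dim_card by simp

lemma dim_le_4: "vec.dim (S :: ('a::field ^ 4) set) \<le> 4"
  using dim_subset_UNIV_cart_gen[of S] by simp

lemma card_points_in:
  assumes "vec.subspace (V :: ('a::{field,finite} ^ 4) set)"
  shows "card {P \<in> pg_points. P \<subseteq> V} = (\<Sum>i<vec.dim V. CARD('a) ^ i)"
proof -
  have "{P \<in> pg_points. P \<subseteq> V} = {U. vec.subspace U \<and> vec.dim U = vec.dim {0::'a^4} + 1 \<and> {0} \<subseteq> U \<and> U \<subseteq> V}"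
    by (auto simp: pg_points_def vec.subspace_0)
  then show ?thesis
    using card_intermediate[of "{0}" V "vec.dim V"] assms by (simp add: vec.subspace_0)
qed

lemma card_lines_between:
  assumes "P \<in> pg_points" "vec.subspace (V :: ('a::{field,finite} ^ 4) set)" "P \<subseteq> V" "vec.dim V = Suc m"
  shows "card {l \<in> pg_lines. P \<subseteq> l \<and> l \<subseteq> V} = (\<Sum>i<m. CARD('a) ^ i)"
proof -
  have "{l \<in> pg_lines. P \<subseteq> l \<and> l \<subseteq> V} = {U. vec.subspace U \<and> vec.dim U = vec.dim P + 1 \<and> P \<subseteq> U \<and> U \<subseteq> V}"
    using pg_pointsD[OF assms(1)] by (auto simp: pg_lines_def)
  then show ?thesis
    using card_intermediate[of P V m] assms pg_pointsD[OF assms(1)] by simp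
qed

lemma card_planes_above:
  assumes "l \<in> (pg_lines :: ('a::{field,finite} ^ 4) set set)"
  shows "card {h \<in> pg_planes. l \<subseteq> h} = CARD('a) + 1"
proof -
  have "{h \<in> pg_planes. l \<subseteq> h} = {U. vec.subspace U \<and> vec.dim U = vec.dim l + 1 \<and> l \<subseteq> U \<and> U \<subseteq> UNIV}"
    using pg_linesD[OF assms] by (auto simp: pg_planes_def)
  then show ?thesis
    using card_intermediate[of l UNIV 2] pg_linesD[OF assms] dim_UNIV_4[where 'a = 'a]
    by (simp add: numeral_2_eq_2)
qed

text \<open>Incident pairs of a point and a line inside \<open>V\<close> are counted in two ways.
  The factor \<open>q + 1\<close>, the number of points on a line, is kept on the left to avoid a
  division.\<close>

lemma card_lines_in_mult:
  assumes "vec.subspace (V :: ('a::{field,finite} ^ 4) set)" "vec.dim V = Suc m"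
  shows "card {l \<in> pg_lines. l \<subseteq> V} * (CARD('a) + 1) = (\<Sum>i<Suc m. CARD('a) ^ i) * (\<Sum>i<m. CARD('a) ^ i)"
proof -
  let ?L = "{l \<in> pg_lines. l \<subseteq> V}" and ?P = "{P \<in> pg_points. P \<subseteq> V}"
  have "(\<Sum>P\<in>?P. int (card {l \<in> ?L. P \<subseteq> l})) = (\<Sum>l\<in>?L. int (card {P \<in> ?P. P \<subseteq> l}))"
    by (rule sum_card_filter_swap) auto
  moreover have "(\<Sum>P\<in>?P. int (card {l \<in> ?L. P \<subseteq> l})) = (\<Sum>P\<in>?P. int (\<Sum>i<m. CARD('a) ^ i))"
  proof (rule sum.cong[OF refl])
    fix P assume P: "P \<in> ?P"
    have "{l \<in> ?L. P \<subseteq> l} = {l \<in> pg_lines. P \<subseteq> l \<and> l \<subseteq> V}" by auto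
    then show "int (card {l \<in> ?L. P \<subseteq> l}) = int (\<Sum>i<m. CARD('a) ^ i)"
      using card_lines_between[of P V m] P assms by simp
  qed
  moreover have "(\<Sum>l\<in>?L. int (card {P \<in> ?P. P \<subseteq> l})) = (\<Sum>l\<in>?L. int (CARD('a) + 1))"
  proof (rule sum.cong[OF refl])
    fix l assume l: "l \<in> ?L"
    have "{P \<in> ?P. P \<subseteq> l} = {P \<in> pg_points. P \<subseteq> l}" using l by auto
    then show "int (card {P \<in> ?P. P \<subseteq> l}) = int (CARD('a) + 1)"
      using card_points_in[of l] l pg_linesD[of l] by (simp add: numeral_2_eq_2)
  qed
  ultimately have "int (card ?P) * int (\<Sum>i<m. CARD('a) ^ i) = int (card ?L) * int (CARD('a) + 1)"
    by simp
  then have "card ?P * (\<Sum>i<m. CARD('a) ^ i) = card ?L * (CARD('a) + 1)"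
    by (simp only: of_nat_mult[symmetric] of_nat_eq_iff)
  then show ?thesis using card_points_in[OF assms(1)] assms(2) by simp
qed

lemma line_inter:
  assumes "l \<in> pg_lines" "m \<in> pg_lines" "l \<noteq> m"
  shows "vec.dim (l \<inter> m) \<le> 1"
proof (rule ccontr)
  assume "\<not> vec.dim (l \<inter> m) \<le> 1"
  then have "l \<inter> m = l" "l \<inter> m = m"
    using pg_linesD[OF assms(1)] pg_linesD[OF assms(2)]
    by (intro subspace_eqI vec.subspace_inter; simp)+
  then show False using assms(3) by simp
qed

lemma point_eqI: "P \<in> pg_points \<Longrightarrow> Q \<in> pg_points \<Longrightarrow> P \<subseteq> Q \<Longrightarrow> P = Q"
  by (rule subspace_eqI) (simp_all add: pg_pointsD)

lemma plane_eqI: "h \<in> pg_planes \<Longrightarrow> k \<in> pg_planes \<Longrightarrow> h \<subseteq> k \<Longrightarrow> h = k"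
  by (rule subspace_eqI) (simp_all add: pg_planesD)

text \<open>For two lines the dimensions of the intersection and the join add up to 4, so a common
  point (dimension 1) means that they span a plane (dimension 3).\<close>

lemma meeting_lines:
  assumes "l \<in> pg_lines" "m \<in> pg_lines" "l \<noteq> m" "P \<in> pg_points" "P \<subseteq> l" "P \<subseteq> m"
  shows "l \<inter> m = P" "join l m \<in> pg_planes"
proof -
  note l = pg_linesD[OF assms(1)] and m = pg_linesD[OF assms(2)] and P = pg_pointsD[OF assms(4)]
  have "P = l \<inter> m"
    using line_inter[OF assms(1-3)] assms(5,6) l m P by (intro subspace_eqI vec.subspace_inter) auto
  then show "l \<inter> m = P" by simp
  then show "join l m \<in> pg_planes"
    using subspace_join[OF l(1) m(1)] dim_join[OF l(1) m(1)] l m P by (simp add: pg_planes_def)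
qed

lemma coplanar_lines:
  assumes "l \<in> pg_lines" "m \<in> pg_lines" "l \<noteq> m" "h \<in> pg_planes" "l \<subseteq> h" "m \<subseteq> h"
  shows "l \<inter> m \<in> pg_points" "join l m = h"
proof -
  note l = pg_linesD[OF assms(1)] and m = pg_linesD[OF assms(2)] and h = pg_planesD[OF assms(4)]
  have sub: "join l m \<subseteq> h" using join_least h(1) assms(5,6) by blast
  then have "vec.dim (join l m) \<le> 3" using vec.dim_subset[OF sub] h by simp
  then have 1: "vec.dim (l \<inter> m) = 1" "vec.dim (join l m) = 3"
    using dim_join[OF l(1) m(1)] line_inter[OF assms(1-3)] l m by auto
  show "l \<inter> m \<in> pg_points" using 1 vec.subspace_inter[OF l(1) m(1)] by (simp add: pg_points_def)
  show "join l m = h" using subspace_join[OF l(1) m(1)] h sub 1 by (intro subspace_eqI) auto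
qed

lemma line_plane_inter:
  assumes "m \<in> pg_lines" "h \<in> pg_planes" "\<not> m \<subseteq> h"
  shows "h \<inter> m \<in> pg_points"
proof -
  note m = pg_linesD[OF assms(1)] and h = pg_planesD[OF assms(2)]
  note J = subspace_join[OF h(1) m(1)] join_upper1[OF h(1) m(1)] join_upper2[OF h(1) m(1)]
  have "\<not> vec.dim (join h m) \<le> 3"
    using subspace_eqI[OF h(1) J(1,2)] h J(3) assms(3) by auto
  then have "vec.dim (join h m) = 4" using dim_le_4[of "join h m"] by linarith
  then have "vec.dim (h \<inter> m) = 1" using dim_join[OF h(1) m(1)] h m by simp
  then show ?thesis using vec.subspace_inter[OF h(1) m(1)] by (simp add: pg_points_def)
qed

lemma point_line_join:
  assumes "P \<in> pg_points" "m \<in> pg_lines" "\<not> P \<subseteq> m"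
  shows "join P m \<in> pg_planes"
proof -
  note P = pg_pointsD[OF assms(1)] and m = pg_linesD[OF assms(2)]
  have "\<not> 1 \<le> vec.dim (P \<inter> m)"
    using subspace_eqI[OF vec.subspace_inter[OF P(1) m(1)] P(1)] P assms(3) by auto
  then show ?thesis
    using dim_join[OF P(1) m(1)] subspace_join[OF P(1) m(1)] P m by (simp add: pg_planes_def)
qed

lemma point_point_join:
  assumes "P \<in> pg_points" "Q \<in> pg_points" "P \<noteq> Q"
  shows "join P Q \<in> pg_lines"
proof -
  note P = pg_pointsD[OF assms(1)] and Q = pg_pointsD[OF assms(2)]
  have "\<not> 1 \<le> vec.dim (P \<inter> Q)"
    using subspace_eqI[OF vec.subspace_inter[OF P(1) Q(1)] P(1)] P point_eqI[OF assms(1,2)] assms(3) by auto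
  then show ?thesis
    using dim_join[OF P(1) Q(1)] subspace_join[OF P(1) Q(1)] P Q by (simp add: pg_lines_def)
qed

lemma join_eq_line:
  assumes "P \<in> pg_points" "Q \<in> pg_points" "P \<noteq> Q" "k \<in> pg_lines" "P \<subseteq> k" "Q \<subseteq> k"
  shows "k = join P Q"
  by (rule subspace_eqI[symmetric])
    (use point_point_join[OF assms(1-3)] join_least[OF pg_linesD(1)[OF assms(4)] assms(5,6)] assms(4)
      in \<open>simp_all add: pg_linesD\<close>)

text \<open>This translates the incidence of a point and a plane, which the abstract axioms express
  by a line between them, into inclusion.\<close>

lemma pencil_nonempty_iff:
  assumes "P \<in> pg_points" "h \<in> (pg_planes :: ('a::{field,finite} ^ 4) set set)"
  shows "(\<exists>k\<in>pg_lines. P \<subseteq> k \<and> k \<subseteq> h) \<longleftrightarrow> P \<subseteq> h"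
proof
  assume P: "P \<subseteq> h"
  have "card {l \<in> pg_lines. P \<subseteq> l \<and> l \<subseteq> h} = CARD('a) + 1"
    using card_lines_between[OF assms(1) pg_planesD(1)[OF assms(2)] P, of 2] pg_planesD(2)[OF assms(2)]
    by (simp add: numeral_2_eq_2)
  then have "{l \<in> pg_lines. P \<subseteq> l \<and> l \<subseteq> h} \<noteq> {}" by (metis card.empty add_is_0 zero_neq_one)
  then show "\<exists>k\<in>pg_lines. P \<subseteq> k \<and> k \<subseteq> h" by blast
qed auto

text \<open>The counting axioms are instances of the count of intermediate subspaces. The others
  follow from the dimension formula, with joins and intersections as witnesses.\<close>

lemma projective_3space_pg:
  "projective_3space pg_points pg_lines (pg_planes :: ('a::{field,finite} ^ 4) set set)
    (\<subseteq>) (\<subseteq>) CARD('a)"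
proof (unfold_locales, goal_cases)
  case (4 l) then show ?case
    using card_points_in[OF pg_linesD(1)[OF 4]] pg_linesD(2)[OF 4] by (simp add: numeral_2_eq_2)
next
  case (5 l) then show ?case by (rule card_planes_above)
next
  case (6 P)
  then show ?case using card_lines_between[of P UNIV 3] dim_UNIV_4[where 'a = 'a]
    by (simp add: numeral_3_eq_3 power2_eq_square)
next
  case (7 h)
  have "card {l \<in> pg_lines. l \<subseteq> h} * (CARD('a) + 1) = (CARD('a)\<^sup>2 + CARD('a) + 1) * (CARD('a) + 1)"
    using card_lines_in_mult[of h 2] pg_planesD[OF 7] by (simp add: numeral_2_eq_2)
  then show ?case by (simp only: mult_cancel2) simp
next
  case (8 P h l)
  then have "P \<subseteq> h" by auto
  then show ?case using card_lines_between[of P h 2] 8 pg_planesD[of h] by (simp add: numeral_2_eq_2)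
next
  case 9
  have "card (pg_lines :: ('a ^ 4) set set) * (CARD('a) + 1) =
      (\<Sum>i<Suc 3. CARD('a) ^ i) * (\<Sum>i<3. CARD('a) ^ i)"
    using card_lines_in_mult[of "UNIV :: ('a ^ 4) set" 3] dim_UNIV_4[where 'a = 'a] by simp
  also have "\<dots> = (CARD('a)\<^sup>2 + 1) * (CARD('a)\<^sup>2 + CARD('a) + 1) * (CARD('a) + 1)"
    by (simp add: numeral_3_eq_3 power2_eq_square algebra_simps)
  finally show ?case by (simp only: mult_cancel2) simp
next
  case (10 l m)
  show ?case
  proof (cases "l = m")
    case True
    have "{P \<in> pg_points. P \<subseteq> l} \<noteq> {}" "{h \<in> pg_planes. l \<subseteq> h} \<noteq> {}"
      using card_points_in[OF pg_linesD(1)[OF 10(1)]] pg_linesD(2)[OF 10(1)] card_planes_above[OF 10(1)]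
      by (auto simp: numeral_2_eq_2 simp del: Collect_empty_eq)
    then show ?thesis using True by blast
  next
    case False
    show ?thesis
    proof
      assume "\<exists>P\<in>pg_points. P \<subseteq> l \<and> P \<subseteq> m"
      then have "join l m \<in> pg_planes" using meeting_lines(2)[OF 10 False] by blast
      then show "\<exists>h\<in>pg_planes. l \<subseteq> h \<and> m \<subseteq> h"
        using join_upper1[OF pg_linesD(1) pg_linesD(1), OF 10] join_upper2[OF pg_linesD(1) pg_linesD(1), OF 10]
        by blast
    next
      assume "\<exists>h\<in>pg_planes. l \<subseteq> h \<and> m \<subseteq> h"
      then have "l \<inter> m \<in> pg_points" using coplanar_lines(1)[OF 10 False] by blast
      then show "\<exists>P\<in>pg_points. P \<subseteq> l \<and> P \<subseteq> m" by blast
    qed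
  qed
next
  case (11 l m P Q)
  then show ?case using meeting_lines(1)[of l m] by metis
next
  case (12 l m h k)
  then show ?case using coplanar_lines(2)[of l m] by metis
next
  case (13 P h l m)
  \<comment> \<open>The transversal must pass through the only point of \<open>m\<close> in
    \<open>h\<close>, so it is the join of \<open>P\<close> with that point.\<close>
  let ?Q = "h \<inter> m"
  have Q: "?Q \<in> pg_points" using line_plane_inter 13 by blast
  have PQ: "P \<noteq> ?Q" using 13 by blast
  note P1 = pg_pointsD(1)[OF 13(1)] and Q1 = pg_pointsD(1)[OF Q]
  show ?case
  proof (rule ex1I[of _ "join P ?Q"])
    have "join P ?Q \<subseteq> h" using join_least[OF pg_planesD(1)[OF 13(2)], of P ?Q] 13 by blast
    then show "join P ?Q \<in> pg_lines \<and> P \<subseteq> join P ?Q \<and> join P ?Q \<subseteq> h \<and>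
        (\<exists>R\<in>pg_points. R \<subseteq> m \<and> R \<subseteq> join P ?Q)"
      using point_point_join[OF 13(1) Q PQ] join_upper1[OF P1 Q1] join_upper2[OF P1 Q1] Q by blast
  next
    fix k assume k: "k \<in> pg_lines \<and> P \<subseteq> k \<and> k \<subseteq> h \<and> (\<exists>R\<in>pg_points. R \<subseteq> m \<and> R \<subseteq> k)"
    then obtain R where R: "R \<in> pg_points" "R \<subseteq> m" "R \<subseteq> k" by blast
    then have "R = ?Q" using point_eqI[OF R(1) Q] k by blast
    then show "k = join P ?Q" using join_eq_line[OF 13(1) Q PQ] k R by blast
  qed
next
  case (14 l m P)
  have nP: "\<not> P \<subseteq> m" using 14 by blast
  note J = point_line_join[OF 14(4,2) nP]
  note P1 = pg_pointsD(1)[OF 14(4)] and m1 = pg_linesD(1)[OF 14(2)]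
  show ?case
  proof (rule ex1I[of _ "join P m"])
    show "join P m \<in> pg_planes \<and> m \<subseteq> join P m \<and> (\<exists>k\<in>pg_lines. P \<subseteq> k \<and> k \<subseteq> join P m)"
      using J join_upper1[OF P1 m1] join_upper2[OF P1 m1] pencil_nonempty_iff[OF 14(4) J] by blast
  next
    fix h assume h: "h \<in> pg_planes \<and> m \<subseteq> h \<and> (\<exists>k\<in>pg_lines. P \<subseteq> k \<and> k \<subseteq> h)"
    then have "join P m \<subseteq> h" using join_least[OF pg_planesD(1)[of h], of P m] by blast
    then show "h = join P m" using plane_eqI[OF J] h by blast
  qed
next
  case (15 l m h)
  have "l \<noteq> m"
  proof
    assume "l = m"
    moreover have "{P \<in> pg_points. P \<subseteq> l} \<noteq> {}"
      using card_points_in[OF pg_linesD(1)[OF 15(1)]] pg_linesD(2)[OF 15(1)]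
      by (auto simp: numeral_2_eq_2 simp del: Collect_empty_eq)
    ultimately show False using 15(3) by blast
  qed
  then have "\<not> m \<subseteq> h" using coplanar_lines(1)[OF 15(1,2) _ 15(4,5)] 15(3) by blast
  then have Q: "h \<inter> m \<in> pg_points" using line_plane_inter 15 by blast
  show ?case
  proof (rule ex1I[of _ "h \<inter> m"])
    show "h \<inter> m \<in> pg_points \<and> h \<inter> m \<subseteq> m \<and> (\<exists>k\<in>pg_lines. h \<inter> m \<subseteq> k \<and> k \<subseteq> h)"
      using Q pencil_nonempty_iff[OF Q 15(4)] by blast
  next
    fix P assume P: "P \<in> pg_points \<and> P \<subseteq> m \<and> (\<exists>k\<in>pg_lines. P \<subseteq> k \<and> k \<subseteq> h)"
    then have "P \<subseteq> h \<inter> m" by blast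
    then show "P = h \<inter> m" using point_eqI P Q by blast
  qed
qed (use CARD_field_gt_1[where 'a = 'a] in simp_all)

section \<open>Transfer to the subspaces of \<open>F^4\<close> for a field with four
  elements\<close>

theorem theorem1:
  assumes "CARD('a::{field,finite}) = 4"
  shows "\<not> (\<exists>(\<L> :: ('a ^ 4) set set) (x::int). x \<in> {4, 5, 6, 8} \<and> cameron_liebler \<L> x)"
proof
  assume "\<exists>(\<L> :: ('a ^ 4) set set) (x::int). x \<in> {4, 5, 6, 8} \<and> cameron_liebler \<L> x"
  then obtain L :: "('a ^ 4) set set" and x :: int where x: "x \<in> {4, 5, 6, 8}" and cl: "cameron_liebler L x"
    by blast
  interpret projective_3space pg_points pg_lines "pg_planes :: ('a ^ 4) set set" "(\<subseteq>)" "(\<subseteq>)" "CARD('a)"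
    by (rule projective_3space_pg)
  have "{m \<in> L. m \<noteq> l \<and> meets m l} = {m \<in> L - {l}. pg_meets m l}" for l
    by (auto simp: meets_def pg_meets_def)
  then interpret cameron_liebler_class_4 pg_points pg_lines "pg_planes :: ('a ^ 4) set set" "(\<subseteq>)" "(\<subseteq>)"
      "CARD('a)" L x
    using cl assms by unfold_locales (simp_all add: cameron_liebler_def)
  show False using x not_4_8 not_5 not_6 by simp
qed

end
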